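(* Let $A$ be a quasi-Hopf (super)algebra of trace type, with invertible even $u\in A$ satisfying $S^2(a)=uau^{-1}$ for all $a\in A$. Let $\pi:A\to\mathrm{End}\,V$ be the representation afforded by a finite-dimensional graded $A$-module $V$. Suppose $\theta=\sum_ia_i\otimes B_i\otimes c_i\in A\otimes\mathrm{End}\,V\otimes A$ obeys $$(1\otimes\pi\otimes1)(1\otimes\Delta)\Delta(a)\cdot\theta=\theta\cdot(1\otimes\pi\otimes1)(1\otimes\Delta)\Delta(a)\quad\text{for all }a\in A.$$ Then $$C=\sum_i\mathrm{Str}_V\big(uS^{-1}(\alpha)B_i\beta S(c_i)\big)\,a_i$$ is a central element of $A$. Similarly, if $\bar\theta=\sum_i\bar a_i\otimes\bar B_i\otimes\bar c_i\in A\otimes\mathrm{End}\,V\otimes A$ satisfies $$\bar\theta\cdot(1\otimes\pi\otimes1)(\Delta\otimes1)\Delta(a)=(1\otimes\pi\otimes1)(\Delta\otimes1)\Delta(a)\cdot\bar\theta\quad\text{for all }a\in A,$$ then $$\bar C=\sum_i\mathrm{Str}_V\big(u^{-1}S(\beta)S(\bar a_i)\alpha\bar B_i\big)\,\bar c_i$$ is a central element of $A$.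
   Context: A quasi-Hopf (super)algebra $(A,\Delta,\epsilon,\Phi)$ is a unital associative $\mathbb Z_2$-graded algebra $A$ over a field $K$ (the ungraded case being $A$ concentrated in degree $0$; $[a]\in\mathbb Z_2$ is the degree of a homogeneous $a$; sign formulas are stated for homogeneous elements and extended linearly), with grading-preserving algebra homomorphisms $\epsilon:A\to K$, $\Delta:A\to A\otimes A$, an invertible homogeneous $\Phi\in A\otimes A\otimes A$, a graded algebra anti-homomorphism $S:A\to A$ (grading preserving, $S(ab)=(-1)^{[a][b]}S(b)S(a)$) and homogeneous $\alpha,\beta\in A$; $S$ is assumed bijective. Tensor products of graded algebras are multiplied by $(a\otimes b)(a'\otimes b')=(-1)^{[b][a']}aa'\otimes bb'$. Write $\Phi=\sum_\nu X_\nu\otimes Y_\nu\otimes Z_\nu$, $\Phi^{-1}=\sum_\nu\bar X_\nu\otimes\bar Y_\nu\otimes\bar Z_\nu$, $\Delta(a)=\sum a_{(1)}\otimes a_{(2)}$ (homogeneous components). The axioms are, for all $a\in A$: $(1\otimes\Delta)\Delta(a)=\Phi^{-1}(\Delta\otimes1)\Delta(a)\Phi$; $(\Delta\otimes1\otimes1)\Phi\cdot(1\otimes1\otimes\Delta)\Phi=(\Phi\otimes1)\cdot(1\otimes\Delta\otimes1)\Phi\cdot(1\otimes\Phi)$; $(\epsilon\otimes1)\Delta=1=(1\otimes\epsilon)\Delta$; $(1\otimes\epsilon\otimes1)\Phi=1$; $\sum S(a_{(1)})\alpha a_{(2)}=\epsilon(a)\alpha$; $\sum a_{(1)}\beta S(a_{(2)})=\epsilon(a)\beta$;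 $\sum\bar X_\nu\beta S(\bar Y_\nu)\alpha\bar Z_\nu=1$; $\sum S(X_\nu)\alpha Y_\nu\beta S(Z_\nu)=1$. These imply that $\Phi,\alpha,\beta$ are even. $A$ is of trace type if there is an invertible even $u\in A$ with $S^2(a)=uau^{-1}$ for all $a\in A$. $\mathrm{Str}_V$ is the supertrace on $\mathrm{End}\,V$ (the ordinary trace in the ungraded case); inside $\mathrm{Str}_V(\cdot)$ elements of $A$ stand for their images under $\pi$. Central means commuting with every element of $A$. *)

theory Defs
  imports Complex_Main "HOL-Library.Z2" "HOL-Library.Function_Algebras"
begin

text \<open>
  \<^bold>\<open>Gradings.\<close> Degrees live in the two-element field \<^typ>\<open>bit\<close>; a \<open>Z\<^sub>2\<close>-grading is a family of
  subspaces \<open>gr 0\<close>, \<open>gr 1\<close> whose direct sum is the whole space (given by its carrier, since the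
  space of endomorphisms is not a type).
\<close>

definition z2_grading ::
    "('k::field \<Rightarrow> 'a::ab_group_add \<Rightarrow> 'a) \<Rightarrow> 'a set \<Rightarrow> (bit \<Rightarrow> 'a set) \<Rightarrow> bool" where
  "z2_grading s X gr \<longleftrightarrow>
     (\<forall>i. module.subspace s (gr i) \<and> gr i \<subseteq> X) \<and>
     (\<forall>x\<in>X. \<exists>y\<in>gr 0. \<exists>z\<in>gr 1. x = y + z) \<and> gr 0 \<inter> gr 1 = {0}"

text \<open>The homogeneous component of degree \<open>i\<close>; note that \<open>i + 1\<close> is the other degree.\<close>

definition comp_of :: "(bit \<Rightarrow> 'a::ab_group_add set) \<Rightarrow> bit \<Rightarrow> 'a \<Rightarrow> 'a" where
  "comp_of gr i x = (THE y. y \<in> gr i \<and> x - y \<in> gr (i + 1))"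

definition parity_sign :: "bit \<Rightarrow> 'k::ring_1" where
  "parity_sign i = (if i = 0 then 1 else - 1)"

locale superalgebra = vector_space scale
  for scale :: "'k::field \<Rightarrow> 'a::ring_1 \<Rightarrow> 'a" +
  fixes gr :: "bit \<Rightarrow> 'a set"
  assumes scale_mult_left: "scale k a * b = scale k (a * b)"
    and scale_mult_right: "a * scale k b = scale k (a * b)"
    and grading: "z2_grading scale UNIV gr"
    and gr_one: "1 \<in> gr 0"
    and gr_mult: "a \<in> gr i \<Longrightarrow> b \<in> gr j \<Longrightarrow> a * b \<in> gr (i + j)"

text \<open>
  \<^bold>\<open>Tensor products.\<close> A tensor in \<open>X \<otimes> Y \<otimes> \<dots>\<close> is written as a formal finite sum
  \<open>\<Sum>\<^sub>i x\<^sub>i \<otimes> y\<^sub>i \<otimes> \<dots>\<close>, that is, as a list of tuples, and the tensor product is the quotient of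
  these formal sums by the congruence generated by multilinearity over the field. Because
  \<open>(- x) \<otimes> y\<close> is an inverse of \<open>x \<otimes> y\<close>, the quotient of the monoid of formal sums is a group.
  The quotients depend on a scalar multiplication and hence are not types, so tensors are
  handled through representing lists and equality of tensors is the relation \<open>tensor_eq\<close>.
  A linear map out of a tensor product is applied to the entries of a list.
\<close>

inductive formal_sum_cong :: "('x list \<Rightarrow> 'x list \<Rightarrow> bool) \<Rightarrow> 'x list \<Rightarrow> 'x list \<Rightarrow> bool"
  for R where
  base: "R xs ys \<Longrightarrow> formal_sum_cong R xs ys"
| refl: "formal_sum_cong R xs xs"
| sym: "formal_sum_cong R xs ys \<Longrightarrow> formal_sum_cong R ys xs"
| trans: "formal_sum_cong R xs ys \<Longrightarrow> formal_sum_cong R ys zs \<Longrightarrow> formal_sum_cong R xs zs"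
| append: "formal_sum_cong R xs ys \<Longrightarrow> formal_sum_cong R us vs \<Longrightarrow>
    formal_sum_cong R (xs @ us) (ys @ vs)"
| commute: "formal_sum_cong R (xs @ ys) (ys @ xs)"

inductive bilinear_rel ::
    "('k::field \<Rightarrow> 'a::ab_group_add \<Rightarrow> 'a) \<Rightarrow> ('a \<times> 'a) list \<Rightarrow> ('a \<times> 'a) list \<Rightarrow> bool"
  for s where
  "bilinear_rel s [(0, b)] []"
| "bilinear_rel s [(a + a', b)] [(a, b), (a', b)]"
| "bilinear_rel s [(a, b + b')] [(a, b), (a, b')]"
| "bilinear_rel s [(s k a, b)] [(a, s k b)]"

text \<open>
  Threefold tensors have a middle factor with carrier \<open>M\<close> and scalar multiplication \<open>t\<close>, so as to
  cover both \<open>A \<otimes> A \<otimes> A\<close> and \<open>A \<otimes> End V \<otimes> A\<close>.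
\<close>

inductive trilinear_rel ::
    "('k::field \<Rightarrow> 'a::ab_group_add \<Rightarrow> 'a) \<Rightarrow> 'm::ab_group_add set \<Rightarrow> ('k \<Rightarrow> 'm \<Rightarrow> 'm) \<Rightarrow>
     ('a \<times> 'm \<times> 'a) list \<Rightarrow> ('a \<times> 'm \<times> 'a) list \<Rightarrow> bool"
  for s M t where
  "m \<in> M \<Longrightarrow> trilinear_rel s M t [(0, m, c)] []"
| "m \<in> M \<Longrightarrow> trilinear_rel s M t [(a + a', m, c)] [(a, m, c), (a', m, c)]"
| "m \<in> M \<Longrightarrow> m' \<in> M \<Longrightarrow> trilinear_rel s M t [(a, m + m', c)] [(a, m, c), (a, m', c)]"
| "m \<in> M \<Longrightarrow> trilinear_rel s M t [(a, m, c + c')] [(a, m, c), (a, m, c')]"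
| "m \<in> M \<Longrightarrow> trilinear_rel s M t [(s k a, m, c)] [(a, t k m, c)]"
| "m \<in> M \<Longrightarrow> trilinear_rel s M t [(s k a, m, c)] [(a, m, s k c)]"

inductive quadrilinear_rel ::
    "('k::field \<Rightarrow> 'a::ab_group_add \<Rightarrow> 'a) \<Rightarrow>
     ('a \<times> 'a \<times> 'a \<times> 'a) list \<Rightarrow> ('a \<times> 'a \<times> 'a \<times> 'a) list \<Rightarrow> bool"
  for s where
  "quadrilinear_rel s [(0, b, c, d)] []"
| "quadrilinear_rel s [(a + a', b, c, d)] [(a, b, c, d), (a', b, c, d)]"
| "quadrilinear_rel s [(a, b + b', c, d)] [(a, b, c, d), (a, b', c, d)]"
| "quadrilinear_rel s [(a, b, c + c', d)] [(a, b, c, d), (a, b, c', d)]"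
| "quadrilinear_rel s [(a, b, c, d + d')] [(a, b, c, d), (a, b, c, d')]"
| "quadrilinear_rel s [(s k a, b, c, d)] [(a, s k b, c, d)]"
| "quadrilinear_rel s [(s k a, b, c, d)] [(a, b, s k c, d)]"
| "quadrilinear_rel s [(s k a, b, c, d)] [(a, b, c, s k d)]"

definition tensor_eq2 where
  "tensor_eq2 s = formal_sum_cong (bilinear_rel s)"

definition tensor_eq3 where
  "tensor_eq3 s M t = formal_sum_cong (trilinear_rel s M t)"

definition tensor_eq4 where
  "tensor_eq4 s = formal_sum_cong (quadrilinear_rel s)"

text \<open>
  Products of tensors. For homogeneous entries
  \<open>(a \<otimes> b)(a' \<otimes> b') = (-1)\<^bsup>[b][a']\<^esup> aa' \<otimes> bb'\<close>, and similarly each primed factor picks up a sign for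
  every unprimed factor it is moved past; general entries are split into homogeneous components.
\<close>

definition tensor_mult2 ::
    "('k::field \<Rightarrow> 'a::ring_1 \<Rightarrow> 'a) \<Rightarrow> (bit \<Rightarrow> 'a set) \<Rightarrow>
     ('a \<times> 'a) list \<Rightarrow> ('a \<times> 'a) list \<Rightarrow> ('a \<times> 'a) list" where
  "tensor_mult2 s gr xs ys =
     [(s (parity_sign (j * p)) (a * comp_of gr p a'), comp_of gr j b * b').
       (a, b) \<leftarrow> xs, (a', b') \<leftarrow> ys, j \<leftarrow> [0, 1], p \<leftarrow> [0, 1]]"

definition tensor_mult3 ::
    "('k::field \<Rightarrow> 'a::ring_1 \<Rightarrow> 'a) \<Rightarrow> (bit \<Rightarrow> 'a set) \<Rightarrow>
     ('m::ab_group_add \<Rightarrow> 'm \<Rightarrow> 'm) \<Rightarrow> (bit \<Rightarrow> 'm set) \<Rightarrow>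
     ('a \<times> 'm \<times> 'a) list \<Rightarrow> ('a \<times> 'm \<times> 'a) list \<Rightarrow> ('a \<times> 'm \<times> 'a) list" where
  "tensor_mult3 s gr f grm xs ys =
     [(s (parity_sign (p * (j + k) + q * k)) (a * comp_of gr p a'),
       f (comp_of grm j b) (comp_of grm q b'),
       comp_of gr k c * c').
       (a, b, c) \<leftarrow> xs, (a', b', c') \<leftarrow> ys,
       j \<leftarrow> [0, 1], k \<leftarrow> [0, 1], p \<leftarrow> [0, 1], q \<leftarrow> [0, 1]]"

definition tensor_mult4 ::
    "('k::field \<Rightarrow> 'a::ring_1 \<Rightarrow> 'a) \<Rightarrow> (bit \<Rightarrow> 'a set) \<Rightarrow>
     ('a \<times> 'a \<times> 'a \<times> 'a) list \<Rightarrow> ('a \<times> 'a \<times> 'a \<times> 'a) list \<Rightarrow> ('a \<times> 'a \<times> 'a \<times> 'a) list" where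
  "tensor_mult4 s gr xs ys =
     [(s (parity_sign (p * (j + k + l) + q * (k + l) + r * l)) (a * comp_of gr p a'),
       comp_of gr j b * comp_of gr q b',
       comp_of gr k c * comp_of gr r c',
       comp_of gr l d * d').
       (a, b, c, d) \<leftarrow> xs, (a', b', c', d') \<leftarrow> ys,
       j \<leftarrow> [0, 1], k \<leftarrow> [0, 1], l \<leftarrow> [0, 1], p \<leftarrow> [0, 1], q \<leftarrow> [0, 1], r \<leftarrow> [0, 1]]"

text \<open>Sums of pure tensors of homogeneous elements of total degree \<open>i\<close>.\<close>

definition homogeneous2 :: "(bit \<Rightarrow> 'a set) \<Rightarrow> bit \<Rightarrow> ('a \<times> 'a) list \<Rightarrow> bool" where
  "homogeneous2 gr i xs \<longleftrightarrow>
     (\<forall>(a, b)\<in>set xs. \<exists>p q. a \<in> gr p \<and> b \<in> gr q \<and> p + q = i)"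

definition homogeneous3 :: "(bit \<Rightarrow> 'a set) \<Rightarrow> bit \<Rightarrow> ('a \<times> 'a \<times> 'a) list \<Rightarrow> bool" where
  "homogeneous3 gr i xs \<longleftrightarrow>
     (\<forall>(a, b, c)\<in>set xs. \<exists>p q r. a \<in> gr p \<and> b \<in> gr q \<and> c \<in> gr r \<and> p + q + r = i)"

text \<open>
  \<^bold>\<open>Quasi-Hopf superalgebras.\<close> \<open>\<Delta> a\<close>, \<open>\<Phi>\<close> and \<open>\<Phi>i\<close> are lists representing the tensors
  \<open>\<Delta>(a)\<close>, \<open>\<Phi>\<close> and \<open>\<Phi>\<^sup>-\<^sup>1\<close>. The ungraded case is \<open>gr 1 = {0}\<close>.
\<close>

locale quasi_hopf_superalgebra = superalgebra scale gr
  for scale :: "'k::field \<Rightarrow> 'a::ring_1 \<Rightarrow> 'a" and gr :: "bit \<Rightarrow> 'a set" +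
  fixes \<Delta> :: "'a \<Rightarrow> ('a \<times> 'a) list"
    and \<epsilon> :: "'a \<Rightarrow> 'k"
    and \<Phi> \<Phi>i :: "('a \<times> 'a \<times> 'a) list"
    and S :: "'a \<Rightarrow> 'a"
    and \<alpha> \<beta> :: 'a
  fixes eq2 (infix "\<approx>\<^sub>2" 50) and eq3 (infix "\<approx>\<^sub>3" 50) and eq4 (infix "\<approx>\<^sub>4" 50)
    and mult2 (infixl "\<cdot>\<^sub>2" 70) and mult3 (infixl "\<cdot>\<^sub>3" 70) and mult4 (infixl "\<cdot>\<^sub>4" 70)
  defines "eq2 \<equiv> tensor_eq2 scale"
    and "eq3 \<equiv> tensor_eq3 scale (UNIV :: 'a set) scale"
    and "eq4 \<equiv> tensor_eq4 scale"
    and "mult2 \<equiv> tensor_mult2 scale gr"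
    and "mult3 \<equiv> tensor_mult3 scale gr (*) gr"
    and "mult4 \<equiv> tensor_mult4 scale gr"
  assumes comult_add: "\<Delta> (a + b) \<approx>\<^sub>2 \<Delta> a @ \<Delta> b"
    and comult_scale: "\<Delta> (scale k a) \<approx>\<^sub>2 [(scale k a1, a2). (a1, a2) \<leftarrow> \<Delta> a]"
    and comult_mult: "\<Delta> (a * b) \<approx>\<^sub>2 \<Delta> a \<cdot>\<^sub>2 \<Delta> b"
    and comult_one: "\<Delta> 1 \<approx>\<^sub>2 [(1, 1)]"
    and comult_even: "a \<in> gr i \<Longrightarrow> \<exists>xs. homogeneous2 gr i xs \<and> \<Delta> a \<approx>\<^sub>2 xs"
    and counit_linear: "Vector_Spaces.linear scale (*) \<epsilon>"
    and counit_mult: "\<epsilon> (a * b) = \<epsilon> a * \<epsilon> b"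
    and counit_one: "\<epsilon> 1 = 1"
    and counit_even: "a \<in> gr 1 \<Longrightarrow> \<epsilon> a = 0"
    and assoc_homogeneous: "\<exists>i xs. homogeneous3 gr i xs \<and> \<Phi> \<approx>\<^sub>3 xs"
    and assoc_right_inverse: "\<Phi> \<cdot>\<^sub>3 \<Phi>i \<approx>\<^sub>3 [(1, 1, 1)]"
    and assoc_left_inverse: "\<Phi>i \<cdot>\<^sub>3 \<Phi> \<approx>\<^sub>3 [(1, 1, 1)]"
    and antipode_linear: "Vector_Spaces.linear scale scale S"
    and antipode_even: "a \<in> gr i \<Longrightarrow> S a \<in> gr i"
    and antipode_mult: "a \<in> gr i \<Longrightarrow> b \<in> gr j \<Longrightarrow>
           S (a * b) = scale (parity_sign (i * j)) (S b * S a)"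
    and antipode_one: "S 1 = 1"
    and antipode_bij: "bij S"
    and alpha_homogeneous: "\<exists>i. \<alpha> \<in> gr i"
    and beta_homogeneous: "\<exists>i. \<beta> \<in> gr i"
    and quasi_coassociative:
      "[(a1, a2, a3). (a1, w) \<leftarrow> \<Delta> a, (a2, a3) \<leftarrow> \<Delta> w] \<approx>\<^sub>3
       \<Phi>i \<cdot>\<^sub>3 [(a1, a2, a3). (w, a3) \<leftarrow> \<Delta> a, (a1, a2) \<leftarrow> \<Delta> w] \<cdot>\<^sub>3 \<Phi>"
    and pentagon:
      "[(x1, x2, y, z). (x, y, z) \<leftarrow> \<Phi>, (x1, x2) \<leftarrow> \<Delta> x] \<cdot>\<^sub>4
       [(x, y, z1, z2). (x, y, z) \<leftarrow> \<Phi>, (z1, z2) \<leftarrow> \<Delta> z] \<approx>\<^sub>4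
       [(x, y, z, 1). (x, y, z) \<leftarrow> \<Phi>] \<cdot>\<^sub>4
       [(x, y1, y2, z). (x, y, z) \<leftarrow> \<Phi>, (y1, y2) \<leftarrow> \<Delta> y] \<cdot>\<^sub>4
       [(1, x, y, z). (x, y, z) \<leftarrow> \<Phi>]"
    and counit_left: "(\<Sum>(a1, a2)\<leftarrow>\<Delta> a. scale (\<epsilon> a1) a2) = a"
    and counit_right: "(\<Sum>(a1, a2)\<leftarrow>\<Delta> a. scale (\<epsilon> a2) a1) = a"
    and counit_assoc: "[(scale (\<epsilon> y) x, z). (x, y, z) \<leftarrow> \<Phi>] \<approx>\<^sub>2 [(1, 1)]"
    and antipode_left: "(\<Sum>(a1, a2)\<leftarrow>\<Delta> a. S a1 * \<alpha> * a2) = scale (\<epsilon> a) \<alpha>"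
    and antipode_right: "(\<Sum>(a1, a2)\<leftarrow>\<Delta> a. a1 * \<beta> * S a2) = scale (\<epsilon> a) \<beta>"
    and antipode_assoc_inverse: "(\<Sum>(x, y, z)\<leftarrow>\<Phi>i. x * \<beta> * S y * \<alpha> * z) = 1"
    and antipode_assoc: "(\<Sum>(x, y, z)\<leftarrow>\<Phi>. S x * \<alpha> * y * \<beta> * S z) = 1"

text \<open>\<^bold>\<open>Modules and endomorphisms.\<close>\<close>

definition endos :: "('k::field \<Rightarrow> 'v::ab_group_add \<Rightarrow> 'v) \<Rightarrow> ('v \<Rightarrow> 'v) set" where
  "endos sV = {f. Vector_Spaces.linear sV sV f}"

definition endo_scale :: "('k \<Rightarrow> 'v \<Rightarrow> 'v) \<Rightarrow> 'k \<Rightarrow> ('v \<Rightarrow> 'v) \<Rightarrow> 'v \<Rightarrow> 'v" where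
  "endo_scale sV k f = (\<lambda>v. sV k (f v))"

definition endo_gr ::
    "('k::field \<Rightarrow> 'v::ab_group_add \<Rightarrow> 'v) \<Rightarrow> (bit \<Rightarrow> 'v set) \<Rightarrow> bit \<Rightarrow> ('v \<Rightarrow> 'v) set" where
  "endo_gr sV grV i = {f \<in> endos sV. \<forall>j. f ` grV j \<subseteq> grV (i + j)}"

locale graded_module = superalgebra scale gr + V: vector_space scaleV
  for scale :: "'k::field \<Rightarrow> 'a::ring_1 \<Rightarrow> 'a" and gr :: "bit \<Rightarrow> 'a set"
    and scaleV :: "'k \<Rightarrow> 'v::ab_group_add \<Rightarrow> 'v" +
  fixes grV :: "bit \<Rightarrow> 'v set"
    and \<pi> :: "'a \<Rightarrow> 'v \<Rightarrow> 'v"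
  assumes grading_V: "z2_grading scaleV UNIV grV"
    and rep_linear: "Vector_Spaces.linear scale (endo_scale scaleV) \<pi>"
    and rep_endo: "\<pi> a \<in> endos scaleV"
    and rep_mult: "\<pi> (a * b) = \<pi> a \<circ> \<pi> b"
    and rep_one: "\<pi> 1 = id"
    and rep_graded: "a \<in> gr i \<Longrightarrow> \<pi> a \<in> endo_gr scaleV grV i"

definition finite_dim :: "('k::field \<Rightarrow> 'v::ab_group_add \<Rightarrow> 'v) \<Rightarrow> bool" where
  "finite_dim sV \<longleftrightarrow> (\<exists>B. finite B \<and> module.span sV B = UNIV)"

definition homogeneous_basis ::
    "('k::field \<Rightarrow> 'v::ab_group_add \<Rightarrow> 'v) \<Rightarrow> (bit \<Rightarrow> 'v set) \<Rightarrow> 'v set \<Rightarrow> bool" where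
  "homogeneous_basis sV grV B \<longleftrightarrow>
     \<not> module.dependent sV B \<and> module.span sV B = UNIV \<and> B \<subseteq> grV 0 \<union> grV 1"

text \<open>
  The supertrace is the alternating sum of the diagonal entries with respect to a homogeneous
  basis; as for the ordinary trace, the value does not depend on the basis chosen.
\<close>

definition supertrace ::
    "('k::field \<Rightarrow> 'v::ab_group_add \<Rightarrow> 'v) \<Rightarrow> (bit \<Rightarrow> 'v set) \<Rightarrow> ('v \<Rightarrow> 'v) \<Rightarrow> 'k" where
  "supertrace sV grV f =
     (let B = (SOME B. homogeneous_basis sV grV B) in
       (\<Sum>b\<in>B \<inter> grV 0. module.representation sV B (f b) b) -
       (\<Sum>b\<in>B \<inter> grV 1. module.representation sV B (f b) b))"

definition tensor_eq_endo where
  "tensor_eq_endo scale scaleV = tensor_eq3 scale (endos scaleV) (endo_scale scaleV)"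

definition tensor_mult_endo where
  "tensor_mult_endo scale gr scaleV grV = tensor_mult3 scale gr (\<circ>) (endo_gr scaleV grV)"

definition central :: "'a::semigroup_mult \<Rightarrow> bool" where
  "central c \<longleftrightarrow> (\<forall>a. c * a = a * c)"

end

theory Submission
  imports Defs
begin

text \<open>
  Write \<open>a\<^sub>1 \<otimes> a\<^sub>2 \<otimes> a\<^sub>3\<close> for the terms of the iterated coproduct of \<open>a\<close>, and apply the linear map
  \<open>x \<otimes> B \<otimes> c \<mapsto> Str(u S\<^sup>-\<^sup>1(\<alpha>) B \<beta> S(c)) x\<close> (\<open>left_term\<close>) to both sides of the commutation hypothesis
  for \<open>\<theta>\<close>. When the coproduct stands on the right, \<open>S(c a\<^sub>3) = S(a\<^sub>3) S(c)\<close> creates the product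
  \<open>a\<^sub>2 \<beta> S(a\<^sub>3)\<close>, which sums to a multiple of \<open>\<beta>\<close> by the antipode axiom; the counit then leaves
  \<open>C a\<close>. When it stands on the left, the factor \<open>S(a\<^sub>3)\<close> ends up at the far right of the
  supertrace. Cyclicity takes it to the front, and \<open>S(a\<^sub>3) u = u S\<^sup>-\<^sup>1(a\<^sub>3)\<close>, which is the trace type
  condition, takes it past \<open>u\<close>, where \<open>S\<^sup>-\<^sup>1(a\<^sub>3) S\<^sup>-\<^sup>1(\<alpha>) a\<^sub>2 = S\<^sup>-\<^sup>1(S(a\<^sub>2) \<alpha> a\<^sub>3)\<close> contracts to a
  multiple of \<open>S\<^sup>-\<^sup>1(\<alpha>)\<close>; this leaves \<open>a C\<close>. The second half is the mirror image: for \<open>right_term\<close> the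
  rotation is needed when the coproduct stands on the right, and \<open>a\<^sub>2 u\<^sup>-\<^sup>1 = u\<^sup>-\<^sup>1 S\<^sup>2(a\<^sub>2)\<close> is used.

  All signs disappear for two reasons. The supertrace kills odd endomorphisms, so only terms of
  total degree zero inside the supertrace contribute; for these, the signs of the graded product,
  of the antipode and of the rotation combine to one that depends on the two factors being
  contracted only through the sum of their degrees (the lemmas named \<open>_homogeneous\<close>). And as
  \<open>\<alpha>\<close> and \<open>\<beta>\<close> are even, the terms of odd total degree in \<open>\<Sum> S(x) \<alpha> y\<close> and \<open>\<Sum> x \<beta> S(y)\<close> already cancel among themselves, so such
  a sign does not affect the contraction (\<open>twisted_contraction\<close>).
\<close>

section \<open>Degrees, signs and formal sums\<close>

text \<open>
  Degrees are treated as elements of the ring \<open>\<int>/2\<close>, so their sums and products must not be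
  rewritten to Boolean operations.
\<close>

declare add_bit_eq_xor [simp del] mult_bit_eq_and [simp del]

lemma UNIV_bit: "(UNIV :: bit set) = {0, 1}"
  by (auto simp: bit_not_zero_iff)

lemma finite_UNIV_bit [simp]: "finite (UNIV :: bit set)"
  by (simp add: UNIV_bit)

lemma sum_UNIV_bit: "(\<Sum>i\<in>UNIV. f i) = f (0 :: bit) + f 1"
  by (simp add: UNIV_bit)

lemma parity_sign_mult: "parity_sign i * parity_sign j = (parity_sign (i + j) :: 'k::ring_1)"
  by (cases i; cases j) (simp_all add: parity_sign_def)

lemma parity_sign_0 [simp]: "parity_sign 0 = 1"
  by (simp add: parity_sign_def)

lemma sum_list_sum_swap:
  "(\<Sum>x\<leftarrow>xs. \<Sum>j\<in>J. f x j) = (\<Sum>j\<in>J. \<Sum>x\<leftarrow>xs. f x j :: 'b::comm_monoid_add)"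
  by (induction xs) (simp_all add: sum.distrib)

lemma sum_list_swap:
  "(\<Sum>x\<leftarrow>xs. \<Sum>y\<leftarrow>ys. f x y) = (\<Sum>y\<leftarrow>ys. \<Sum>x\<leftarrow>xs. f x y :: 'b::comm_monoid_add)"
  by (induction xs) (simp_all add: sum_list_addf)

lemma additive_sum_list:
  assumes "K 0 = 0" and "\<And>x y. K (x + y) = K x + K y"
  shows "K (\<Sum>x\<leftarrow>xs. f x) = (\<Sum>x\<leftarrow>xs. K (f x))"
  using assms by (induction xs) simp_all

lemma additive_sum:
  assumes "K 0 = 0" and "\<And>x y. K (x + y) = K x + K y"
  shows "K (\<Sum>x\<in>J. f x) = (\<Sum>x\<in>J. K (f x))"
  using assms by (induction J rule: infinite_finite_induct) simp_all

lemma sum_list_concat: "(\<Sum>x\<leftarrow>concat xss. f x) = (\<Sum>xs\<leftarrow>xss. \<Sum>x\<leftarrow>xs. f x :: 'b::monoid_add)"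
  by (induction xss) simp_all

text \<open>
  A map on pure tensors that respects the defining relations is well defined on the tensor
  product.
\<close>

lemma formal_sum_cong_sum_list_eq:
  fixes F :: "'x \<Rightarrow> 'b::comm_monoid_add"
  assumes "formal_sum_cong R xs ys"
    and "\<And>xs ys. R xs ys \<Longrightarrow> (\<Sum>x\<leftarrow>xs. F x) = (\<Sum>x\<leftarrow>ys. F x)"
  shows "(\<Sum>x\<leftarrow>xs. F x) = (\<Sum>x\<leftarrow>ys. F x)"
  using assms(1) by induction (simp_all add: assms(2) add.commute)

lemma sum_list_tensor_mult3:
  "(\<Sum>z\<leftarrow>tensor_mult3 s gr f grm xs ys. F z) =
     (\<Sum>(a, b, c)\<leftarrow>xs. \<Sum>(a', b', c')\<leftarrow>ys.
        \<Sum>j\<in>UNIV. \<Sum>k\<in>UNIV. \<Sum>p\<in>UNIV. \<Sum>q\<in>UNIV.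
          F (s (parity_sign (p * (j + k) + q * k)) (a * comp_of gr p a'),
             f (comp_of grm j b) (comp_of grm q b'), comp_of gr k c * c'))"
  by (simp add: tensor_mult3_def case_prod_unfold sum_list_concat o_def
      sum_UNIV_bit add.assoc)

section \<open>Graded vector spaces\<close>

locale z2_graded_space = vector_space s
  for s :: "'k::field \<Rightarrow> 'x::ab_group_add \<Rightarrow> 'x" +
  fixes X :: "'x set" and gr :: "bit \<Rightarrow> 'x set"
  assumes z2_grading: "z2_grading s X gr"
begin

lemma gr_subspace: "subspace (gr i)"
  and gr_Int: "gr 0 \<inter> gr 1 = {0}"
  using z2_grading by (auto simp: z2_grading_def)

lemma gr_disjoint: "x \<in> gr i \<Longrightarrow> x \<in> gr (i + 1) \<Longrightarrow> x = 0"
  using gr_Int by (cases i) auto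

lemma gr_zero [simp]: "0 \<in> gr i"
  and gr_add: "x \<in> gr i \<Longrightarrow> y \<in> gr i \<Longrightarrow> x + y \<in> gr i"
  and gr_diff: "x \<in> gr i \<Longrightarrow> y \<in> gr i \<Longrightarrow> x - y \<in> gr i"
  and gr_scale: "x \<in> gr i \<Longrightarrow> s k x \<in> gr i"
  and gr_sum_list: "(\<And>z. z \<in> set zs \<Longrightarrow> f z \<in> gr i) \<Longrightarrow> (\<Sum>z\<leftarrow>zs. f z) \<in> gr i"
proof -
  show "0 \<in> gr i" "(\<And>z. z \<in> set zs \<Longrightarrow> f z \<in> gr i) \<Longrightarrow> (\<Sum>z\<leftarrow>zs. f z) \<in> gr i"
    using gr_subspace by (induction zs) (auto simp: subspace_0 subspace_add)
qed (use gr_subspace in \<open>auto simp: subspace_add subspace_diff subspace_scale\<close>)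

lemma comp_eqI:
  assumes "y \<in> gr i" and "x - y \<in> gr (i + 1)"
  shows "comp_of gr i x = y"
  unfolding comp_of_def
proof (rule the_equality)
  fix y' assume y': "y' \<in> gr i \<and> x - y' \<in> gr (i + 1)"
  have "(x - y) - (x - y') \<in> gr (i + 1)" using assms y' by (blast intro: gr_diff)
  then have "y' - y \<in> gr (i + 1)" by simp
  moreover have "y' - y \<in> gr i" using assms y' by (blast intro: gr_diff)
  ultimately show "y' = y" using gr_disjoint by force
qed (use assms in blast)

lemma comp_works:
  assumes "x \<in> X"
  shows "comp_of gr i x \<in> gr i" and "x - comp_of gr i x \<in> gr (i + 1)"
proof -
  obtain y z where "y \<in> gr 0" "z \<in> gr 1" "x = y + z"
    using assms z2_grading by (auto simp: z2_grading_def)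
  then have "\<exists>y. y \<in> gr i \<and> x - y \<in> gr (i + 1)"
    by (cases i) (force, force intro: exI[of _ z])
  then obtain y where y: "y \<in> gr i" "x - y \<in> gr (i + 1)" by blast
  then have "comp_of gr i x = y" by (rule comp_eqI)
  with y show "comp_of gr i x \<in> gr i" "x - comp_of gr i x \<in> gr (i + 1)" by auto
qed

lemma sum_comp:
  assumes "x \<in> X"
  shows "(\<Sum>i\<in>UNIV. comp_of gr i x) = x"
proof -
  have "comp_of gr 1 x = x - comp_of gr 0 x"
    using comp_works[OF assms, of 0] by (intro comp_eqI) auto
  then show ?thesis by (simp add: sum_UNIV_bit)
qed

lemma comp_homogeneous:
  assumes "x \<in> gr i"
  shows "comp_of gr j x = (if j = i then x else 0)"
  using assms by (cases i; cases j) (auto intro!: comp_eqI)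

lemma comp_add: "x \<in> X \<Longrightarrow> y \<in> X \<Longrightarrow> comp_of gr i (x + y) = comp_of gr i x + comp_of gr i y"
  using gr_add[OF comp_works(2)[of x i] comp_works(2)[of y i]]
  by (intro comp_eqI gr_add) (simp_all add: comp_works add_diff_add)

lemma comp_scale: "x \<in> X \<Longrightarrow> comp_of gr i (s k x) = s k (comp_of gr i x)"
  using gr_scale[OF comp_works(2)[of x i], of k]
  by (intro comp_eqI gr_scale) (simp_all add: comp_works scale_right_diff_distrib)

text \<open>
  If the sum of an even and an odd element is even, then the odd element is zero, and a sign
  attached to it is immaterial.
\<close>

lemma twisted_sum_eq:
  assumes "e 0 \<in> gr 0" and "e 1 \<in> gr 1" and "e 0 + e 1 \<in> gr 0"
  shows "(\<Sum>i\<in>UNIV. s (parity_sign (t * i)) (e i)) = e 0 + e (1 :: bit)"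
proof -
  have "(e 0 + e 1) - e 0 \<in> gr 0" using assms by (blast intro: gr_diff)
  then have "e 1 = 0" using assms gr_disjoint[of "e 1" 0] by simp
  then show ?thesis by (simp add: sum_UNIV_bit)
qed

end

section \<open>The supertrace\<close>

locale finite_dim_graded_space = V: z2_graded_space sV UNIV grV
  for sV :: "'k::field \<Rightarrow> 'v::ab_group_add \<Rightarrow> 'v" and grV :: "bit \<Rightarrow> 'v set" +
  assumes finite_dim: "finite_dim sV"
begin

text \<open>
  The homogeneous components of a finite spanning set still span, so they contain a basis.
\<close>

lemma homogeneous_basis_exists: "\<exists>B. homogeneous_basis sV grV B"
proof -
  obtain T where T: "finite T" "V.span T = UNIV"
    using finite_dim by (auto simp: finite_dim_def)
  define H where "H = (\<Union>i. comp_of grV i ` T)"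
  obtain B where B: "B \<subseteq> H" "V.independent B" "H \<subseteq> V.span B"
    using V.maximal_independent_subset[of H] by blast
  have "T \<subseteq> V.span B"
  proof
    fix x assume "x \<in> T"
    then have "comp_of grV i x \<in> V.span B" for i
      using B(3) by (auto simp: H_def)
    then have "(\<Sum>i\<in>UNIV. comp_of grV i x) \<in> V.span B"
      by (blast intro: V.span_sum)
    then show "x \<in> V.span B" by (simp add: V.sum_comp)
  qed
  then have "V.span B = UNIV"
    using T(2) V.span_minimal[OF _ V.subspace_span, of T B] by auto
  moreover have "B \<subseteq> grV 0 \<union> grV 1"
  proof
    fix b assume "b \<in> B"
    then obtain i x where "b = comp_of grV i x" using B(1) by (auto simp: H_def)
    then show "b \<in> grV 0 \<union> grV 1" using V.comp_works(1)[of x i] by (cases i) auto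
  qed
  ultimately show ?thesis using B(2) unfolding homogeneous_basis_def by blast
qed

definition str_basis :: "'v set" where
  "str_basis = (SOME B. homogeneous_basis sV grV B)"

definition coord :: "'v \<Rightarrow> 'v \<Rightarrow> 'k" where
  "coord v b = V.representation str_basis v b"

definition deg :: "'v \<Rightarrow> bit" where
  "deg b = (if b \<in> grV 0 then 0 else 1)"

lemma
  shows str_basis_independent: "V.independent str_basis"
    and str_basis_span: "V.span str_basis = UNIV"
    and str_basis_homogeneous: "b \<in> str_basis \<Longrightarrow> b \<in> grV (deg b)"
    and finite_str_basis: "finite str_basis"
proof -
  have *: "homogeneous_basis sV grV str_basis"
    unfolding str_basis_def by (rule someI_ex[OF homogeneous_basis_exists])
  show ind: "V.independent str_basis" and "V.span str_basis = UNIV"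
    and "b \<in> str_basis \<Longrightarrow> b \<in> grV (deg b)"
    using * by (auto simp: homogeneous_basis_def deg_def)
  show "finite str_basis"
    using finite_dim V.independent_span_bound[OF _ ind] by (auto simp: finite_dim_def)
qed

lemma coord_add: "coord (v + w) b = coord v b + coord w b"
  and coord_scale: "coord (sV k v) b = k * coord v b"
  using V.representation_add[OF str_basis_independent] V.representation_scale[OF str_basis_independent]
  by (simp_all add: coord_def str_basis_span)

lemma coord_sum: "coord (\<Sum>x\<in>J. f x) b = (\<Sum>x\<in>J. coord (f x) b)"
  using V.representation_sum[OF str_basis_independent, of J f]
  by (simp add: coord_def str_basis_span)

lemma sum_coord: "(\<Sum>b\<in>str_basis. sV (coord v b) b) = v"
  unfolding coord_def
  by (intro V.sum_representation_eq) (use str_basis_independent str_basis_span finite_str_basis in auto)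

text \<open>
  The part of the basis expansion of \<open>v\<close> over basis vectors of the other degree equals \<open>v\<close> minus
  the remaining part, so it has both degrees and vanishes; its coefficients are then zero.
\<close>

lemma coord_homogeneous:
  assumes "v \<in> grV i" and "b \<in> str_basis" and "deg b \<noteq> i"
  shows "coord v b = 0"
proof -
  let ?part = "\<lambda>P. \<Sum>b | b \<in> str_basis \<and> P b. sV (coord v b) b"
  have split: "v = ?part (\<lambda>b. deg b = i) + ?part (\<lambda>b. deg b \<noteq> i)"
  proof -
    have "(\<Sum>b\<in>str_basis. sV (coord v b) b) =
        ?part (\<lambda>b. deg b = i) + ?part (\<lambda>b. deg b \<noteq> i)"
      using finite_str_basis by (subst sum.union_disjoint[symmetric]) (auto intro!: sum.cong)
    then show ?thesis by (simp add: sum_coord)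
  qed
  have in_gr: "?part (\<lambda>b. deg b = l) \<in> grV l" for l
    using str_basis_homogeneous
    by (intro V.subspace_sum[OF V.gr_subspace]) (auto intro!: V.gr_scale)
  have neq: "(deg b \<noteq> i) = (deg b = i + 1)" for b
    by (cases "deg b"; cases i) auto
  have "?part (\<lambda>b. deg b \<noteq> i) = v - ?part (\<lambda>b. deg b = i)"
    unfolding eq_diff_eq by (subst (2) split) (rule add.commute)
  then have "?part (\<lambda>b. deg b \<noteq> i) \<in> grV i"
    using assms(1) in_gr[of i] by (simp add: V.gr_diff)
  moreover have "?part (\<lambda>b. deg b \<noteq> i) \<in> grV (i + 1)"
    unfolding neq by (rule in_gr)
  ultimately have "?part (\<lambda>b. deg b \<noteq> i) = 0" by (rule V.gr_disjoint)
  then show ?thesis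
    by (rule V.independentD[OF str_basis_independent _ _ _, rotated 2])
      (use finite_str_basis assms(2,3) in auto)
qed

lemma supertrace_eq:
  "supertrace sV grV f = (\<Sum>b\<in>str_basis. parity_sign (deg b) * coord (f b) b)"
proof -
  let ?t = "\<lambda>b. coord (f b) b"
  have B0: "str_basis \<inter> grV 0 = {b \<in> str_basis. deg b = 0}"
    by (auto simp: deg_def)
  \<comment> \<open>A basis vector is nonzero and therefore has only one degree.\<close>
  have B1: "str_basis \<inter> grV 1 = {b \<in> str_basis. deg b \<noteq> 0}"
  proof -
    have "0 \<notin> str_basis" using str_basis_independent V.dependent_zero by blast
    then show ?thesis
      using V.gr_Int str_basis_homogeneous by (force simp: deg_def)
  qed
  have "supertrace sV grV f = (\<Sum>b | b \<in> str_basis \<and> deg b = 0. ?t b) - (\<Sum>b | b \<in> str_basis \<and> deg b \<noteq> 0. ?t b)"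
    unfolding supertrace_def Let_def str_basis_def[symmetric] coord_def[symmetric] B0 B1 ..
  also have "\<dots> = (\<Sum>b | b \<in> str_basis \<and> deg b = 0. parity_sign (deg b) * ?t b)
       + (\<Sum>b | b \<in> str_basis \<and> deg b \<noteq> 0. parity_sign (deg b) * ?t b)"
    by (simp add: parity_sign_def sum_negf)
  also have "\<dots> = (\<Sum>b\<in>str_basis. parity_sign (deg b) * ?t b)"
    using finite_str_basis by (subst sum.union_disjoint[symmetric]) (auto intro!: sum.cong)
  finally show ?thesis .
qed

lemma supertrace_add: "supertrace sV grV (f + g) = supertrace sV grV f + supertrace sV grV g"
  by (simp add: supertrace_eq coord_add algebra_simps sum.distrib)

lemma supertrace_scale: "supertrace sV grV (endo_scale sV k f) = k * supertrace sV grV f"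
  by (simp add: supertrace_eq endo_scale_def coord_scale sum_distrib_left mult.left_commute)

lemma endo_gr_apply: "f \<in> endo_gr sV grV i \<Longrightarrow> v \<in> grV j \<Longrightarrow> f v \<in> grV (i + j)"
  by (auto simp: endo_gr_def)

lemma supertrace_odd:
  assumes "f \<in> endo_gr sV grV 1"
  shows "supertrace sV grV f = 0"
  unfolding supertrace_eq
proof (rule sum.neutral, rule ballI)
  fix b assume b: "b \<in> str_basis"
  have "f b \<in> grV (1 + deg b)"
    by (rule endo_gr_apply[OF assms str_basis_homogeneous[OF b]])
  moreover have "deg b \<noteq> 1 + deg b" by (cases "deg b") auto
  ultimately show "parity_sign (deg b) * coord (f b) b = 0"
    using coord_homogeneous b by simp
qed

text \<open>
  For homogeneous \<open>f\<close> and \<open>g\<close> the sign in the cyclicity of the supertrace is \<open>(-1)\<^bsup>[f][g]\<^esup>\<close>. Both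
  sides vanish unless \<open>[f] = [g]\<close>, so the exponent may be replaced by \<open>[f]\<close>; in this form the
  identity is linear in \<open>g\<close> and extends to all endomorphisms.
\<close>

lemma supertrace_cyclic:
  assumes f: "f \<in> endo_gr sV grV i" and g: "g \<in> endos sV"
  shows "supertrace sV grV (f \<circ> g) = parity_sign i * supertrace sV grV (g \<circ> f)"
proof -
  let ?B = str_basis
  have expand: "coord (h v) b = (\<Sum>c\<in>?B. coord v c * coord (h c) b)"
    if "h \<in> endos sV" for h v b
  proof -
    interpret h: Vector_Spaces.linear sV sV h using that by (simp add: endos_def)
    have "h v = h (\<Sum>c\<in>?B. sV (coord v c) c)" by (simp add: sum_coord)
    then show ?thesis by (simp add: h.sum h.scale coord_sum coord_scale)
  qed
  have f_endo: "f \<in> endos sV" using f by (simp add: endo_gr_def)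
  have sign: "parity_sign (deg b) * coord (f c) b = parity_sign i * (parity_sign (deg c) * coord (f c) b)"
    if "b \<in> ?B" "c \<in> ?B" for b c
  proof (cases "deg b = i + deg c")
    case True
    then show ?thesis by (simp add: parity_sign_mult mult.assoc[symmetric])
  next
    case False
    have "f c \<in> grV (i + deg c)"
      by (rule endo_gr_apply[OF f str_basis_homogeneous[OF that(2)]])
    then show ?thesis using coord_homogeneous that(1) False by simp
  qed
  have "supertrace sV grV (f \<circ> g) =
      (\<Sum>b\<in>?B. \<Sum>c\<in>?B. coord (g b) c * (parity_sign (deg b) * coord (f c) b))"
    by (simp add: supertrace_eq expand[OF f_endo, of "g _"] sum_distrib_left mult_ac)
  also have "\<dots> = (\<Sum>b\<in>?B. \<Sum>c\<in>?B. coord (g b) c * (parity_sign i * (parity_sign (deg c) * coord (f c) b)))"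
    by (simp only: sign cong: sum.cong)
  also have "\<dots> = parity_sign i * (\<Sum>c\<in>?B. \<Sum>b\<in>?B. parity_sign (deg c) * (coord (f c) b * coord (g b) c))"
    by (subst sum.swap) (simp add: sum_distrib_left mult_ac)
  also have "\<dots> = parity_sign i * supertrace sV grV (g \<circ> f)"
    by (simp add: supertrace_eq expand[OF g, of "f _"] sum_distrib_left)
  finally show ?thesis .
qed

end

section \<open>The antipode\<close>

context superalgebra
begin

sublocale A: z2_graded_space scale UNIV gr
  by unfold_locales (rule grading)

abbreviation cmp :: "bit \<Rightarrow> 'a \<Rightarrow> 'a" where
  "cmp \<equiv> comp_of gr"

lemma cmp_in [simp]: "cmp i x \<in> gr i"
  by (simp add: A.comp_works)

lemma sum_cmp: "(\<Sum>i\<in>UNIV. cmp i x) = x"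
  by (simp add: A.sum_comp)

lemma gr_mult_even: "a \<in> gr i \<Longrightarrow> b \<in> gr 0 \<Longrightarrow> a * b \<in> gr i"
  and gr_even_mult: "a \<in> gr 0 \<Longrightarrow> b \<in> gr i \<Longrightarrow> a * b \<in> gr i"
  using gr_mult[of a i b 0] gr_mult[of a 0 b i] by simp_all

text \<open>
  The terms \<open>m x\<^sub>j y\<^sub>k\<close> of odd total degree \<open>j + k\<close> cancel because the whole sum is even; hence a
  sign that only depends on the total degree does no harm.
\<close>

lemma twisted_contraction:
  fixes K :: "'a \<Rightarrow> 'a"
  assumes m_add_left: "\<And>x x' y. m (x + x') y = m x y + m x' y"
    and m_add_right: "\<And>x y y'. m x (y + y') = m x y + m x y'"
    and m_graded: "\<And>x y j k. x \<in> gr j \<Longrightarrow> y \<in> gr k \<Longrightarrow> m x y \<in> gr (j + k)"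
    and total: "(\<Sum>(x, y)\<leftarrow>xs. m x y) = g" and g: "g \<in> gr 0"
    and K_add: "\<And>x y. K (x + y) = K x + K y"
    and K_scale: "\<And>k x. K (scale k x) = scale k (K x)"
  shows "(\<Sum>(x, y)\<leftarrow>xs. \<Sum>j\<in>UNIV. \<Sum>k\<in>UNIV.
            scale (parity_sign (t * (j + k))) (K (m (cmp j x) (cmp k y)))) = K g"
proof -
  have K_0: "K 0 = 0" using K_scale[of 0 0] by simp
  \<comment> \<open>\<open>e i\<close> collects the terms of total degree \<open>i\<close>: modulo two, \<open>j + k = i\<close> means \<open>k = i + j\<close>.\<close>
  define e where "e = (\<lambda>i. \<Sum>(x, y)\<leftarrow>xs. \<Sum>j\<in>UNIV. m (cmp j x) (cmp (i + j) y))"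
  have split: "(\<Sum>i\<in>UNIV. \<Sum>j\<in>UNIV. h i j (i + j)) = (\<Sum>j\<in>UNIV. \<Sum>k\<in>UNIV. h (j + k) j k)"
    for h :: "bit \<Rightarrow> bit \<Rightarrow> bit \<Rightarrow> 'a"
    by (simp add: sum_UNIV_bit add_ac)
  have m_split: "(\<Sum>j\<in>UNIV. \<Sum>k\<in>UNIV. m (cmp j x) (cmp k y)) = m x y" for x y
  proof -
    have "(\<Sum>j\<in>UNIV. \<Sum>k\<in>UNIV. m (cmp j x) (cmp k y)) = m (\<Sum>j\<in>UNIV. cmp j x) (\<Sum>k\<in>UNIV. cmp k y)"
      unfolding sum_UNIV_bit by (simp add: m_add_left m_add_right)
    then show ?thesis by (simp add: sum_cmp)
  qed
  have "e 0 + e 1 = (\<Sum>i\<in>UNIV. e i)" by (simp add: sum_UNIV_bit)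
  also have "\<dots> = (\<Sum>(x, y)\<leftarrow>xs. m x y)"
    unfolding e_def case_prod_unfold sum_list_sum_swap[symmetric] 
      split[of "\<lambda>_ j k. m (cmp j (fst z)) (cmp k (snd z))" for z] m_split ..
  finally have e_total: "e 0 + e 1 = g" by (simp only: total)
  have e_in: "e i \<in> gr i" for i
  proof -
    have "m (cmp j x) (cmp (i + j) y) \<in> gr i" for j x y
      using m_graded[of "cmp j x" j "cmp (i + j) y" "i + j"] by (cases i; cases j) simp_all
    then have "(\<Sum>j\<in>UNIV. m (cmp j x) (cmp (i + j) y)) \<in> gr i" for x y
      unfolding sum_UNIV_bit by (blast intro: A.gr_add)
    then show ?thesis unfolding e_def by (auto intro!: A.gr_sum_list)
  qed
  have "(\<Sum>(x, y)\<leftarrow>xs. \<Sum>j\<in>UNIV. \<Sum>k\<in>UNIV.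
            scale (parity_sign (t * (j + k))) (K (m (cmp j x) (cmp k y)))) =
        (\<Sum>z\<leftarrow>xs. \<Sum>i\<in>UNIV. \<Sum>j\<in>UNIV.
            scale (parity_sign (t * i)) (K (m (cmp j (fst z)) (cmp (i + j) (snd z)))))"
    unfolding case_prod_unfold
      split[of "\<lambda>i j k. scale (parity_sign (t * i)) (K (m (cmp j (fst z)) (cmp k (snd z))))" for z] ..
  also have "\<dots> = K (\<Sum>i\<in>UNIV. scale (parity_sign (t * i)) (e i))"
    unfolding e_def case_prod_unfold additive_sum[of K, OF K_0 K_add] additive_sum_list[of K, OF K_0 K_add]
      K_scale sum_list_sum_swap scale_sum_right
      additive_sum_list[of "scale _", OF scale_zero_right scale_right_distrib] ..
  also have "\<dots> = K g"
    using A.twisted_sum_eq[of e t] e_in g e_total by simp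
  finally show ?thesis .
qed

end

context quasi_hopf_superalgebra
begin

lemma S_add: "S (a + b) = S a + S b"
  and S_scale: "S (scale k a) = scale k (S a)"
  using antipode_linear by (auto simp: Vector_Spaces.linear_iff)

lemma S_0: "S 0 = 0"
  using S_scale[of 0 0] by simp

lemma S_uminus: "S (- a) = - S a"
  using S_scale[of "- 1" a] by simp

lemma inv_S: "inv S (S a) = a" and S_inv: "S (inv S a) = a"
  using antipode_bij by (simp_all add: bij_is_inj bij_is_surj surj_f_inv_f)

lemma inv_S_add: "inv S (a + b) = inv S a + inv S b"
  by (metis inv_S S_inv S_add)

lemma inv_S_scale: "inv S (scale k a) = scale k (inv S a)"
  by (metis inv_S S_inv S_scale)

text \<open>
  The component of \<open>S\<^sup>-\<^sup>1(a)\<close> of the wrong degree has an image under \<open>S\<close> that lies in both degrees, so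
  it is zero.
\<close>

lemma inv_S_graded:
  assumes "a \<in> gr i"
  shows "inv S a \<in> gr i"
proof -
  let ?b = "\<lambda>j. cmp j (inv S a)"
  have b: "inv S a = ?b i + ?b (i + 1)"
    using sum_cmp[of "inv S a"] by (cases i) (simp_all add: sum_UNIV_bit add.commute)
  then have "S (?b (i + 1)) = a - S (?b i)"
    by (metis S_inv S_add add_diff_cancel_left')
  then have "S (?b (i + 1)) \<in> gr i"
    using assms antipode_even[OF cmp_in, of i "inv S a"] by (simp add: A.gr_diff)
  then have "S (?b (i + 1)) = 0"
    using antipode_even[OF cmp_in] A.gr_disjoint by blast
  then have "?b (i + 1) = 0" by (metis inv_S S_0)
  with b show ?thesis by (metis add.right_neutral cmp_in)
qed

lemma inv_S_mult:
  assumes "a \<in> gr i" and "b \<in> gr j"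
  shows "inv S (a * b) = scale (parity_sign (i * j)) (inv S b * inv S a)"
proof -
  have "S (inv S b * inv S a) = scale (parity_sign (j * i)) (a * b)"
    using antipode_mult[OF inv_S_graded[OF assms(2)] inv_S_graded[OF assms(1)]] by (simp add: S_inv)
  then have "S (scale (parity_sign (i * j)) (inv S b * inv S a)) = a * b"
    by (cases i; cases j) (simp_all add: S_uminus parity_sign_def)
  then show ?thesis by (metis inv_S)
qed

text \<open>
  Applying the counit to \<open>\<Sum> S(X) \<alpha> Y \<beta> S(Z) = 1\<close> shows that \<open>\<epsilon>(\<alpha>)\<close> and \<open>\<epsilon>(\<beta>)\<close> are nonzero,
  whereas the counit kills odd elements.
\<close>

lemma alpha_even: "\<alpha> \<in> gr 0" and beta_even: "\<beta> \<in> gr 0"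
proof -
  have e_add: "\<epsilon> (a + b) = \<epsilon> a + \<epsilon> b" and e_scale: "\<epsilon> (scale k a) = k * \<epsilon> a" for a b k
    using counit_linear by (auto simp: Vector_Spaces.linear_iff)
  have e_0: "\<epsilon> 0 = 0" using e_scale[of 0 0] by simp
  have "(\<Sum>t\<leftarrow>\<Phi>. \<epsilon> (case t of (x, y, z) \<Rightarrow> S x * \<alpha> * y * \<beta> * S z)) = 1"
    using antipode_assoc counit_one by (simp add: additive_sum_list[of \<epsilon>, OF e_0 e_add, symmetric])
  then have sum1: "(\<Sum>t\<leftarrow>\<Phi>. case t of (x, y, z) \<Rightarrow> \<epsilon> (S x) * \<epsilon> \<alpha> * \<epsilon> y * \<epsilon> \<beta> * \<epsilon> (S z)) = 1"
    by (simp add: case_prod_unfold counit_mult)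
  have "\<epsilon> \<alpha> \<noteq> 0" "\<epsilon> \<beta> \<noteq> 0"
    using sum1 by (auto simp: case_prod_unfold)
  then have "\<alpha> \<notin> gr 1" "\<beta> \<notin> gr 1" using counit_even by blast+
  moreover obtain i j where "\<alpha> \<in> gr i" "\<beta> \<in> gr j" using alpha_homogeneous beta_homogeneous by blast
  ultimately show "\<alpha> \<in> gr 0" "\<beta> \<in> gr 0" by (cases i; cases j; simp)+
qed

lemma antipode_left_twisted:
  assumes "\<And>x y. K (x + y) = K x + K y" and "\<And>k x. K (scale k x) = scale k (K x)"
  shows "(\<Sum>(x, y)\<leftarrow>\<Delta> w. \<Sum>j\<in>UNIV. \<Sum>k\<in>UNIV.
            scale (parity_sign (t * (j + k))) (K (S (cmp j x) * \<alpha> * cmp k y))) = scale (\<epsilon> w) (K \<alpha>)"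
  using twisted_contraction[of "\<lambda>x y. S x * \<alpha> * y" "\<Delta> w" "scale (\<epsilon> w) \<alpha>" K t]
  by (simp add: assms S_add antipode_left A.gr_scale alpha_even distrib_left distrib_right
      gr_mult gr_mult_even antipode_even)

lemma antipode_right_twisted:
  assumes "\<And>x y. K (x + y) = K x + K y" and "\<And>k x. K (scale k x) = scale k (K x)"
  shows "(\<Sum>(x, y)\<leftarrow>\<Delta> w. \<Sum>j\<in>UNIV. \<Sum>k\<in>UNIV.
            scale (parity_sign (t * (j + k))) (K (cmp j x * \<beta> * S (cmp k y)))) = scale (\<epsilon> w) (K \<beta>)"
  using twisted_contraction[of "\<lambda>x y. x * \<beta> * S y" "\<Delta> w" "scale (\<epsilon> w) \<beta>" K t]
  by (simp add: assms S_add antipode_right A.gr_scale beta_even distrib_left distrib_right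
      gr_mult gr_mult_even antipode_even)

end

section \<open>Endomorphisms of a graded module\<close>

context graded_module
begin

sublocale VG: z2_graded_space scaleV UNIV grV
  by unfold_locales (rule grading_V)

lemma endo_iff: "f \<in> endos scaleV \<longleftrightarrow>
    (\<forall>v w. f (v + w) = f v + f w) \<and> (\<forall>k v. f (scaleV k v) = scaleV k (f v))"
  by (simp add: endos_def Vector_Spaces.linear_iff V.vector_space_axioms)

lemma endo_add: "f \<in> endos scaleV \<Longrightarrow> f (v + w) = f v + f w"
  and endo_scaleV: "f \<in> endos scaleV \<Longrightarrow> f (scaleV k v) = scaleV k (f v)"
  by (simp_all add: endo_iff)

lemma endo_zero: "f \<in> endos scaleV \<Longrightarrow> f 0 = 0"
  using endo_scaleV[of f 0 0] by simp

lemma endo_comp: "f \<in> endos scaleV \<Longrightarrow> g \<in> endos scaleV \<Longrightarrow> f \<circ> g \<in> endos scaleV"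
  by (simp add: endo_iff)

lemma endo_gr_comp:
  "f \<in> endo_gr scaleV grV i \<Longrightarrow> g \<in> endo_gr scaleV grV j \<Longrightarrow> f \<circ> g \<in> endo_gr scaleV grV (i + j)"
  by (auto simp: endo_gr_def endo_comp image_subset_iff add.assoc)

lemma vector_space_endo_scale: "vector_space (endo_scale scaleV)"
  by unfold_locales
    (simp_all add: endo_scale_def fun_eq_iff V.scale_right_distrib V.scale_left_distrib)

lemma z2_grading_endos: "z2_grading (endo_scale scaleV) (endos scaleV) (endo_gr scaleV grV)"
proof -
  interpret E: vector_space "endo_scale scaleV" by (rule vector_space_endo_scale)
  have "E.subspace (endo_gr scaleV grV i)" for i
    by (rule E.subspaceI)
      (auto simp: endo_gr_def endo_iff endo_scale_def image_subset_iff V.scale_right_distrib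
        mult.commute add_ac intro: VG.gr_add VG.gr_scale)
  moreover have "\<exists>B0\<in>endo_gr scaleV grV 0. \<exists>B1\<in>endo_gr scaleV grV 1. B = B0 + B1"
    if B: "B \<in> endos scaleV" for B
  proof -
    \<comment> \<open>The degree \<open>i\<close> part of \<open>B\<close> maps degree \<open>j\<close> to the degree \<open>i + j\<close> part of its image under \<open>B\<close>.\<close>
    define part where "part = (\<lambda>i v. \<Sum>j\<in>UNIV. comp_of grV (i + j) (B (comp_of grV j v)))"
    have "part i \<in> endos scaleV" for i
      by (simp add: endo_iff part_def sum_UNIV_bit VG.comp_add VG.comp_scale endo_add[OF B]
          endo_scaleV[OF B] V.scale_right_distrib add_ac)
    moreover have "part i v \<in> grV (i + l)" if "v \<in> grV l" for i l v
    proof -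
      have "part i v = comp_of grV (i + l) (B v)"
        using that by (cases l)
          (simp_all add: part_def sum_UNIV_bit VG.comp_homogeneous endo_zero[OF B]
            VG.comp_homogeneous[OF VG.gr_zero])
      then show ?thesis by (simp add: VG.comp_works)
    qed
    ultimately have "part i \<in> endo_gr scaleV grV i" for i
      by (auto simp: endo_gr_def)
    moreover have "B = part 0 + part 1"
    proof
      fix v
      have "(part 0 + part 1) v = (\<Sum>j\<in>UNIV. \<Sum>i\<in>UNIV. comp_of grV i (B (comp_of grV j v)))"
        by (simp add: part_def sum_UNIV_bit add_ac)
      also have "\<dots> = B (comp_of grV 0 v + comp_of grV 1 v)"
        by (simp add: VG.sum_comp) (simp add: sum_UNIV_bit endo_add[OF B])
      also have "\<dots> = B v" using VG.sum_comp[of v] by (simp add: sum_UNIV_bit)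
      finally show "B v = (part 0 + part 1) v" ..
    qed
    ultimately show ?thesis by blast
  qed
  moreover have "B = 0" if "B \<in> endo_gr scaleV grV 0" "B \<in> endo_gr scaleV grV 1" for B
  proof
    fix v
    have B: "B \<in> endos scaleV" using that by (simp add: endo_gr_def)
    have "B (comp_of grV j v) = 0" for j
    proof (rule VG.gr_disjoint[of _ j])
      show "B (comp_of grV j v) \<in> grV j" "B (comp_of grV j v) \<in> grV (j + 1)"
        using that VG.comp_works(1)[of v j]
        by (auto simp: endo_gr_def image_subset_iff add.commute[of j])
    qed
    then have "B (comp_of grV 0 v + comp_of grV 1 v) = 0" by (simp add: endo_add[OF B])
    then show "B v = 0 v" using VG.sum_comp[of v] by (simp add: sum_UNIV_bit)
  qed
  moreover have "0 \<in> endo_gr scaleV grV i" for i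
    by (auto simp: endo_gr_def endo_iff)
  ultimately show ?thesis
    unfolding z2_grading_def by (auto simp: endo_gr_def)
qed

sublocale E: z2_graded_space "endo_scale scaleV" "endos scaleV" "endo_gr scaleV grV"
  by (intro z2_graded_space.intro vector_space_endo_scale z2_graded_space_axioms.intro z2_grading_endos)

abbreviation cmpE :: "bit \<Rightarrow> ('v \<Rightarrow> 'v) \<Rightarrow> 'v \<Rightarrow> 'v" where
  "cmpE \<equiv> comp_of (endo_gr scaleV grV)"

lemma rep_add: "\<pi> (a + b) = \<pi> a + \<pi> b"
  and rep_scale: "\<pi> (scale k a) = endo_scale scaleV k (\<pi> a)"
  using rep_linear by (auto simp: Vector_Spaces.linear_iff)

lemma cmpE_rep: "cmpE i (\<pi> a) = \<pi> (cmp i a)"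
proof -
  have "a - cmp i a \<in> gr (i + 1)" by (simp add: A.comp_works)
  then have "\<pi> (a - cmp i a) \<in> endo_gr scaleV grV (i + 1)" by (rule rep_graded)
  moreover have "\<pi> (a - cmp i a) = \<pi> a - \<pi> (cmp i a)"
    by (metis rep_add eq_diff_eq)
  ultimately show ?thesis by (intro E.comp_eqI rep_graded) simp_all
qed

text \<open>
  Keeping the factors on both sides of \<open>B\<close> as elements of \<open>A\<close>, rather than as operators on \<open>V\<close>,
  makes the axioms of the antipode applicable inside the supertrace.
\<close>

definition str_between :: "'a \<Rightarrow> ('v \<Rightarrow> 'v) \<Rightarrow> 'a \<Rightarrow> 'k" where
  "str_between a B b = supertrace scaleV grV (\<pi> a \<circ> B \<circ> \<pi> b)"

lemma str_between_rep_left: "str_between a (\<pi> x \<circ> B) b = str_between (a * x) B b"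
  and str_between_rep_right: "str_between a (B \<circ> \<pi> x) b = str_between a B (x * b)"
  by (simp_all add: str_between_def rep_mult o_assoc)

end

locale finite_dim_graded_module = graded_module scale gr scaleV grV \<pi>
  for scale :: "'k::field \<Rightarrow> 'a::ring_1 \<Rightarrow> 'a" and gr :: "bit \<Rightarrow> 'a set"
    and scaleV :: "'k \<Rightarrow> 'v::ab_group_add \<Rightarrow> 'v" and grV :: "bit \<Rightarrow> 'v set"
    and \<pi> :: "'a \<Rightarrow> 'v \<Rightarrow> 'v" +
  assumes finite_dim: "finite_dim scaleV"
begin

sublocale F: finite_dim_graded_space scaleV grV
  by unfold_locales (rule finite_dim)

lemma str_between_add_left: "str_between (a + a') B b = str_between a B b + str_between a' B b"
  and str_between_scale_left: "str_between (scale k a) B b = k * str_between a B b"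
  and str_between_add_mid: "str_between a (B + B') b = str_between a B b + str_between a B' b"
  and str_between_scale_mid: "str_between a (endo_scale scaleV k B) b = k * str_between a B b"
  by (simp_all add: str_between_def rep_add rep_scale F.supertrace_add[symmetric]
      F.supertrace_scale[symmetric] endo_scale_def o_def plus_fun_def endo_add[OF rep_endo] endo_scaleV[OF rep_endo])

lemma
  assumes "B \<in> endos scaleV"
  shows str_between_add_right: "str_between a B (b + b') = str_between a B b + str_between a B b'"
    and str_between_scale_right: "str_between a B (scale k b) = k * str_between a B b"
  by (simp_all add: str_between_def rep_add rep_scale F.supertrace_add[symmetric]
      F.supertrace_scale[symmetric] endo_scale_def o_def plus_fun_def endo_add[OF rep_endo] endo_scaleV[OF rep_endo]
      endo_add[OF assms] endo_scaleV[OF assms])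

lemma str_between_sum_comp:
  assumes "B \<in> endos scaleV"
  shows "(\<Sum>q\<in>UNIV. str_between a (cmpE q B) b) = str_between a B b"
  using E.sum_comp[OF assms] by (simp add: sum_UNIV_bit str_between_add_mid[symmetric])

lemma str_between_odd:
  assumes "a \<in> gr i" "B \<in> endo_gr scaleV grV q" "b \<in> gr k" "i + q + k \<noteq> 0"
  shows "str_between a B b = 0"
proof -
  have "\<pi> a \<circ> B \<circ> \<pi> b \<in> endo_gr scaleV grV (i + q + k)"
    using assms by (blast intro: endo_gr_comp rep_graded)
  then show ?thesis
    using assms(4) F.supertrace_odd by (simp add: str_between_def bit_not_zero_iff)
qed

lemma str_between_cyclic:
  assumes "b \<in> gr k" "B \<in> endos scaleV"
  shows "str_between (b * a) B b' = parity_sign k * str_between a B (b' * b)"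
  using F.supertrace_cyclic[OF rep_graded[OF assms(1)], of "\<pi> a \<circ> B \<circ> \<pi> b'"] assms(2)
  by (simp add: str_between_def rep_mult o_assoc endo_comp rep_endo)

text \<open>
  The value of a linear map on \<open>A \<otimes> End V \<otimes> A\<close> at the graded product of two pure tensors.
\<close>

definition at_product ::
    "('a \<times> ('v \<Rightarrow> 'v) \<times> 'a \<Rightarrow> 'a) \<Rightarrow> 'a \<times> ('v \<Rightarrow> 'v) \<times> 'a \<Rightarrow> 'a \<times> ('v \<Rightarrow> 'v) \<times> 'a \<Rightarrow> 'a" where
  "at_product F = (\<lambda>(a, B, c) (a', B', c').
     \<Sum>j\<in>UNIV. \<Sum>k\<in>UNIV. \<Sum>p\<in>UNIV. \<Sum>q\<in>UNIV.
       F (scale (parity_sign (p * (j + k) + q * k)) (a * cmp p a'),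
          cmpE j B \<circ> cmpE q B', cmp k c * c'))"

lemma sum_list_tensor_mult_endo:
  "(\<Sum>z\<leftarrow>tensor_mult_endo scale gr scaleV grV xs ys. F z) = (\<Sum>x\<leftarrow>xs. \<Sum>y\<leftarrow>ys. at_product F x y)"
  unfolding tensor_mult_endo_def sum_list_tensor_mult3 at_product_def case_prod_unfold ..

end

section \<open>Contracting a graded product with the coproduct\<close>

locale trace_type_module =
  quasi_hopf_superalgebra scale gr \<Delta> \<epsilon> \<Phi> \<Phi>i S \<alpha> \<beta> + finite_dim_graded_module scale gr scaleV grV \<pi>
  for scale :: "'k::field \<Rightarrow> 'a::ring_1 \<Rightarrow> 'a" and gr :: "bit \<Rightarrow> 'a set"
    and \<Delta> :: "'a \<Rightarrow> ('a \<times> 'a) list" and \<epsilon> :: "'a \<Rightarrow> 'k"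
    and \<Phi> \<Phi>i :: "('a \<times> 'a \<times> 'a) list" and S :: "'a \<Rightarrow> 'a" and \<alpha> \<beta> :: 'a
    and scaleV :: "'k \<Rightarrow> 'v::ab_group_add \<Rightarrow> 'v" and grV :: "bit \<Rightarrow> 'v set"
    and \<pi> :: "'a \<Rightarrow> 'v \<Rightarrow> 'v" +
  fixes u u_inv :: 'a
  assumes u_even: "u \<in> gr 0" and u_right_inverse: "u * u_inv = 1" and u_left_inverse: "u_inv * u = 1"
    and S_S: "S (S a) = u * a * u_inv"
begin

text \<open>
  In \<open>u u\<^sup>-\<^sup>1 = 1\<close> the odd part of \<open>u\<^sup>-\<^sup>1\<close> contributes nothing, so its even part already inverts \<open>u\<close>.
\<close>

lemma u_inv_even: "u_inv \<in> gr 0"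
proof -
  have 1: "u * cmp 0 u_inv + u * cmp 1 u_inv = 1"
    using sum_cmp[of u_inv] u_right_inverse by (simp add: sum_UNIV_bit distrib_left[symmetric])
  then have "1 - u * cmp 0 u_inv \<in> gr 1"
    by (metis add_diff_cancel_left' cmp_in gr_even_mult u_even)
  moreover have "1 - u * cmp 0 u_inv \<in> gr 0"
    by (intro A.gr_diff gr_one gr_even_mult[OF u_even] cmp_in)
  ultimately have "u * cmp 0 u_inv = 1" using A.gr_disjoint[of _ 0] by force
  then have "u_inv = cmp 0 u_inv"
    by (metis mult.assoc mult.left_neutral mult.right_neutral u_left_inverse)
  then show ?thesis by (metis cmp_in)
qed

text \<open>
  The two forms in which \<open>S\<^sup>2(a) = u a u\<^sup>-\<^sup>1\<close> is applied: after a cyclic rotation of the supertrace they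
  carry an element of \<open>A\<close> past \<open>u\<close> or \<open>u\<^sup>-\<^sup>1\<close>.
\<close>

lemma S_mult_u: "S a * u = u * inv S a"
proof -
  have "S a = u * inv S a * u_inv" using S_S[of "inv S a"] by (simp add: S_inv)
  then show ?thesis by (simp add: mult.assoc u_left_inverse)
qed

lemma mult_u_inv: "a * u_inv = u_inv * S (S a)"
  by (simp add: S_S mult.assoc[symmetric] u_left_inverse)

text \<open>
  The linear maps \<open>A \<otimes> End V \<otimes> A \<rightarrow> A\<close> whose values at \<open>\<theta>\<close> and \<open>\<theta>\<close>-bar are \<open>C\<close> and \<open>C\<close>-bar.
\<close>

definition left_term :: "'a \<times> ('v \<Rightarrow> 'v) \<times> 'a \<Rightarrow> 'a" where
  "left_term = (\<lambda>(a, B, c). scale (str_between (u * inv S \<alpha>) B (\<beta> * S c)) a)"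

definition right_term :: "'a \<times> ('v \<Rightarrow> 'v) \<times> 'a \<Rightarrow> 'a" where
  "right_term = (\<lambda>(a, B, c). scale (str_between (u_inv * S \<beta> * S a * \<alpha>) B 1) c)"

lemma sum_S_mult_cmp: "(\<Sum>r\<in>UNIV. S (y * cmp r c)) = S (y * c)"
  "(\<Sum>r\<in>UNIV. S (cmp r c * y)) = S (c * y)"
  by (simp_all add: sum_UNIV_bit S_add[symmetric] distrib_left[symmetric] distrib_right[symmetric]
      sum_cmp[unfolded sum_UNIV_bit])

lemmas even_elements = alpha_even beta_even u_even u_inv_even inv_S_graded[OF alpha_even]

lemma endo_gr_endo: "B \<in> endo_gr scaleV grV i \<Longrightarrow> B \<in> endos scaleV"
  by (simp add: endo_gr_def)

text \<open>
  For homogeneous entries the signs come from \<open>S (y c)\<close>, from rotating \<open>S y\<close> to the front of the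
  supertrace, and from \<open>S\<^sup>-\<^sup>1(S(x) \<alpha> y)\<close>; they add up to \<open>k r + k + j k\<close>. Where the supertrace does not
  vanish, \<open>j + q + k + r = 0\<close>, and then this exponent equals \<open>q k\<close>.
\<close>

lemma left_term_comult_left_homogeneous:
  assumes x: "x \<in> gr j" and y: "y \<in> gr k" and B: "B \<in> endo_gr scaleV grV q" and c: "c \<in> gr r"
  shows "parity_sign (q * k) * str_between (u * inv S \<alpha>) (\<pi> x \<circ> B) (\<beta> * S (y * c)) =
    str_between (u * inv S (S x * \<alpha> * y)) B (\<beta> * S c)"
proof -
  define X where "X = str_between (u * inv S \<alpha> * x) B (\<beta> * S c * S y)"
  have B': "B \<in> endos scaleV" using B by (rule endo_gr_endo)
  have lhs: "str_between (u * inv S \<alpha>) (\<pi> x \<circ> B) (\<beta> * S (y * c)) = parity_sign (k * r) * X"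
    by (simp add: X_def str_between_rep_left antipode_mult[OF y c] scale_mult_right
        str_between_scale_right[OF B'] mult.assoc)
  have "inv S (S x * \<alpha> * y) = scale (parity_sign (j * k)) (inv S y * (inv S \<alpha> * x))"
    using inv_S_mult[of "S x * \<alpha>" j y k] inv_S_mult[of "S x" j \<alpha> 0] x y
    by (simp add: gr_mult_even alpha_even antipode_even inv_S)
  then have "u * inv S (S x * \<alpha> * y) = scale (parity_sign (j * k)) (S y * (u * inv S \<alpha> * x))"
    by (simp add: scale_mult_right mult.assoc[symmetric] S_mult_u)
  then have rhs: "str_between (u * inv S (S x * \<alpha> * y)) B (\<beta> * S c) =
      parity_sign (j * k) * (parity_sign k * X)"
    by (simp add: X_def str_between_scale_left str_between_cyclic[OF antipode_even[OF y] B'])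
  have "X = 0" if "j + q + k + r \<noteq> 0"
  proof -
    have "u * inv S \<alpha> * x \<in> gr (0 + 0 + j)" "\<beta> * S c * S y \<in> gr (0 + r + k)"
      by (intro gr_mult antipode_even even_elements x y c)+
    then show ?thesis unfolding X_def using that B
      by (auto intro!: str_between_odd simp: add_ac)
  qed
  then show ?thesis
    unfolding lhs rhs by (cases j; cases k; cases q; cases r) (simp_all add: parity_sign_def)
qed

text \<open>
  The map \<open>K p\<close> in the proof is the linear function of \<open>S(x) \<alpha> y\<close> that remains once the components of
  \<open>B\<close> and \<open>c\<close> have been recombined; the remaining sign depends on \<open>x\<close> and \<open>y\<close> only through their
  total degree. The three lemmas about the other products are proved in the same way.
\<close>

lemma left_term_comult_left:
  assumes B: "B \<in> endos scaleV"
  shows "(\<Sum>(x, y)\<leftarrow>\<Delta> w. at_product left_term (a1, \<pi> x, y) (a, B, c)) =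
    scale (\<epsilon> w) (a1 * left_term (a, B, c))"
proof -
  have "(\<Sum>q\<in>UNIV. parity_sign (q * k) * str_between (u * inv S \<alpha>) (\<pi> (cmp j x) \<circ> cmpE q B) (\<beta> * S (cmp k y * c)))
      = str_between (u * inv S (S (cmp j x) * \<alpha> * cmp k y)) B (\<beta> * S c)" (is "?l = ?r") for x y j k
  proof -
    have q: "cmpE q B \<in> endo_gr scaleV grV q" for q using E.comp_works(1)[OF B] .
    have "?l = (\<Sum>q\<in>UNIV. \<Sum>r\<in>UNIV. parity_sign (q * k) *
        str_between (u * inv S \<alpha>) (\<pi> (cmp j x) \<circ> cmpE q B) (\<beta> * S (cmp k y * cmp r c)))"
      by (subst sum_S_mult_cmp(1)[symmetric])
        (simp add: sum_UNIV_bit str_between_add_right endo_comp rep_endo endo_gr_endo[OF q] distrib_left)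
    also have "\<dots> = (\<Sum>q\<in>UNIV. \<Sum>r\<in>UNIV.
        str_between (u * inv S (S (cmp j x) * \<alpha> * cmp k y)) (cmpE q B) (\<beta> * S (cmp r c)))"
      by (simp only: left_term_comult_left_homogeneous[OF cmp_in cmp_in q cmp_in])
    also have "\<dots> = (\<Sum>r\<in>UNIV. str_between (u * inv S (S (cmp j x) * \<alpha> * cmp k y)) B (\<beta> * S (cmp r c)))"
      by (subst sum.swap) (simp only: str_between_sum_comp[OF B])
    also have "\<dots> = ?r"
      using sum_S_mult_cmp(1)[of 1 c]
      by (simp add: sum_UNIV_bit str_between_add_right[OF B, symmetric] distrib_left[symmetric])
    finally show ?thesis .
  qed
  note collect = this
  define K where "K = (\<lambda>p z. scale (str_between (u * inv S z) B (\<beta> * S c)) (a1 * cmp p a))"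
  have K: "K p (x + y) = K p x + K p y" "K p (scale k x) = scale k (K p x)" for p x y k
    by (simp_all add: K_def inv_S_add inv_S_scale distrib_left scale_mult_right
        str_between_add_left str_between_scale_left scale_left_distrib)
  have "at_product left_term (a1, \<pi> x, y) (a, B, c) = (\<Sum>p\<in>UNIV. \<Sum>j\<in>UNIV. \<Sum>k\<in>UNIV.
      scale (parity_sign (p * (j + k))) (K p (S (cmp j x) * \<alpha> * cmp k y)))" for x y
  proof -
    have "at_product left_term (a1, \<pi> x, y) (a, B, c) = (\<Sum>j\<in>UNIV. \<Sum>k\<in>UNIV. \<Sum>p\<in>UNIV.
        scale (parity_sign (p * (j + k)) * (\<Sum>q\<in>UNIV. parity_sign (q * k) *
          str_between (u * inv S \<alpha>) (\<pi> (cmp j x) \<circ> cmpE q B) (\<beta> * S (cmp k y * c)))) (a1 * cmp p a))"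
      by (simp add: at_product_def left_term_def cmpE_rep scale_sum_left sum_distrib_left
          parity_sign_mult[symmetric] mult_ac)
    also have "\<dots> = (\<Sum>j\<in>UNIV. \<Sum>k\<in>UNIV. \<Sum>p\<in>UNIV.
        scale (parity_sign (p * (j + k))) (K p (S (cmp j x) * \<alpha> * cmp k y)))"
      by (simp add: collect K_def)
    also have "\<dots> = (\<Sum>p\<in>UNIV. \<Sum>j\<in>UNIV. \<Sum>k\<in>UNIV.
        scale (parity_sign (p * (j + k))) (K p (S (cmp j x) * \<alpha> * cmp k y)))"
      by (simp add: sum_UNIV_bit add_ac)
    finally show ?thesis .
  qed
  then have "(\<Sum>(x, y)\<leftarrow>\<Delta> w. at_product left_term (a1, \<pi> x, y) (a, B, c)) =
      (\<Sum>p\<in>UNIV. \<Sum>(x, y)\<leftarrow>\<Delta> w. \<Sum>j\<in>UNIV. \<Sum>k\<in>UNIV.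
        scale (parity_sign (p * (j + k))) (K p (S (cmp j x) * \<alpha> * cmp k y)))"
    by (simp add: case_prod_unfold sum_list_sum_swap)
  also have "\<dots> = scale (\<epsilon> w) (\<Sum>p\<in>UNIV. K p \<alpha>)"
    by (simp add: antipode_left_twisted[of "K _", OF K] scale_sum_right)
  also have "(\<Sum>p\<in>UNIV. K p \<alpha>) = a1 * left_term (a, B, c)"
    using sum_cmp[of a] by (simp add: K_def left_term_def scale_mult_right scale_sum_right[symmetric]
        sum_distrib_left[symmetric])
  finally show ?thesis .
qed

text \<open>
  Here \<open>x\<close> and \<open>S(y)\<close> meet around \<open>\<beta>\<close> without any rotation. With the sign \<open>k r\<close> of \<open>S (c y)\<close> the
  exponent is \<open>p (j + k) + q k + k r\<close>, and \<open>j + k = q + r\<close> where the supertrace does not vanish.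
\<close>

lemma left_term_comult_right_homogeneous:
  assumes x: "x \<in> gr q" and y: "y \<in> gr r" and B: "B \<in> endo_gr scaleV grV j" and c: "c \<in> gr k"
  shows "parity_sign (p * (j + k) + q * k) * str_between (u * inv S \<alpha>) (B \<circ> \<pi> x) (\<beta> * S (c * y)) =
    parity_sign ((p + k) * (q + r)) * str_between (u * inv S \<alpha>) B (x * \<beta> * S y * S c)"
proof -
  define X where "X = str_between (u * inv S \<alpha>) B (x * \<beta> * S y * S c)"
  have lhs: "str_between (u * inv S \<alpha>) (B \<circ> \<pi> x) (\<beta> * S (c * y)) = parity_sign (k * r) * X"
    by (simp add: X_def str_between_rep_right antipode_mult[OF c y] scale_mult_right
        str_between_scale_right[OF endo_gr_endo[OF B]] mult.assoc)
  have "X = 0" if "j + q + k + r \<noteq> 0"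
  proof -
    have "u * inv S \<alpha> \<in> gr (0 + 0)" "x * \<beta> * S y * S c \<in> gr (q + 0 + r + k)"
      by (intro gr_mult antipode_even even_elements x y c)+
    then show ?thesis unfolding X_def using that B
      by (auto intro!: str_between_odd simp: add_ac)
  qed
  then show ?thesis
    unfolding lhs X_def[symmetric]
    by (cases j; cases k; cases q; cases r; cases p) (simp_all add: parity_sign_def)
qed

lemma left_term_comult_right:
  assumes B: "B \<in> endos scaleV"
  shows "(\<Sum>(x, y)\<leftarrow>\<Delta> w. at_product left_term (a, B, c) (a1, \<pi> x, y)) =
    scale (\<epsilon> w) (left_term (a, B, c) * a1)"
proof -
  have Bj: "cmpE j B \<in> endo_gr scaleV grV j" for j using E.comp_works(1)[OF B] .
  note Bj' = endo_gr_endo[OF Bj]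
  define K where "K = (\<lambda>p j k z. scale (str_between (u * inv S \<alpha>) (cmpE j B) (z * S (cmp k c))) (a * cmp p a1))"
  have K: "K p j k (x + y) = K p j k x + K p j k y" "K p j k (scale l x) = scale l (K p j k x)" for p j k x y l
    by (simp_all add: K_def distrib_right scale_mult_left
        str_between_add_right[OF Bj'] str_between_scale_right[OF Bj'] scale_left_distrib)
  have "at_product left_term (a, B, c) (a1, \<pi> x, y) = (\<Sum>p\<in>UNIV. \<Sum>j\<in>UNIV. \<Sum>k\<in>UNIV. \<Sum>q\<in>UNIV. \<Sum>r\<in>UNIV.
      scale (parity_sign ((p + k) * (q + r))) (K p j k (cmp q x * \<beta> * S (cmp r y))))" for x y
  proof -
    have split: "str_between (u * inv S \<alpha>) (cmpE j B \<circ> \<pi> (cmp q x)) (\<beta> * S (cmp k c * y)) =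
        (\<Sum>r\<in>UNIV. str_between (u * inv S \<alpha>) (cmpE j B \<circ> \<pi> (cmp q x)) (\<beta> * S (cmp k c * cmp r y)))" for j k q
      by (subst sum_S_mult_cmp(1)[symmetric])
        (simp add: sum_UNIV_bit str_between_add_right endo_comp rep_endo Bj' distrib_left)
    have "at_product left_term (a, B, c) (a1, \<pi> x, y) =
      (\<Sum>j\<in>UNIV. \<Sum>k\<in>UNIV. \<Sum>p\<in>UNIV. \<Sum>q\<in>UNIV. \<Sum>r\<in>UNIV.
        scale (parity_sign (p * (j + k) + q * k) *
          str_between (u * inv S \<alpha>) (cmpE j B \<circ> \<pi> (cmp q x)) (\<beta> * S (cmp k c * cmp r y))) (a * cmp p a1))"
      by (simp add: at_product_def left_term_def cmpE_rep split scale_sum_left sum_distrib_left mult_ac)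
    also have "\<dots> = (\<Sum>j\<in>UNIV. \<Sum>k\<in>UNIV. \<Sum>p\<in>UNIV. \<Sum>q\<in>UNIV. \<Sum>r\<in>UNIV.
      scale (parity_sign ((p + k) * (q + r))) (K p j k (cmp q x * \<beta> * S (cmp r y))))"
      by (simp add: left_term_comult_right_homogeneous[OF cmp_in cmp_in Bj cmp_in] K_def)
    also have "\<dots> = (\<Sum>p\<in>UNIV. \<Sum>j\<in>UNIV. \<Sum>k\<in>UNIV. \<Sum>q\<in>UNIV. \<Sum>r\<in>UNIV.
      scale (parity_sign ((p + k) * (q + r))) (K p j k (cmp q x * \<beta> * S (cmp r y))))"
      by (simp add: sum_UNIV_bit add_ac)
    finally show ?thesis .
  qed
  then have "(\<Sum>(x, y)\<leftarrow>\<Delta> w. at_product left_term (a, B, c) (a1, \<pi> x, y)) =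
      (\<Sum>p\<in>UNIV. \<Sum>j\<in>UNIV. \<Sum>k\<in>UNIV. \<Sum>(x, y)\<leftarrow>\<Delta> w. \<Sum>q\<in>UNIV. \<Sum>r\<in>UNIV.
      scale (parity_sign ((p + k) * (q + r))) (K p j k (cmp q x * \<beta> * S (cmp r y))))"
    by (simp add: case_prod_unfold sum_list_sum_swap)
  also have "\<dots> = scale (\<epsilon> w) (\<Sum>p\<in>UNIV. \<Sum>k\<in>UNIV. \<Sum>j\<in>UNIV. K p j k \<beta>)"
    by (simp add: antipode_right_twisted[of "K _ _ _", OF K] scale_sum_right)
      (simp add: sum_UNIV_bit add_ac)
  also have "(\<Sum>p\<in>UNIV. \<Sum>k\<in>UNIV. \<Sum>j\<in>UNIV. K p j k \<beta>) =
      (\<Sum>p\<in>UNIV. scale (\<Sum>k\<in>UNIV. str_between (u * inv S \<alpha>) B (\<beta> * S (cmp k c))) (a * cmp p a1))"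
    by (simp add: K_def scale_sum_left str_between_sum_comp[OF B, symmetric])
  also have "(\<Sum>k\<in>UNIV. str_between (u * inv S \<alpha>) B (\<beta> * S (cmp k c))) = str_between (u * inv S \<alpha>) B (\<beta> * S c)"
    using sum_S_mult_cmp(1)[of 1 c]
    by (simp add: sum_UNIV_bit str_between_add_right[OF B, symmetric] distrib_left[symmetric])
  also have "(\<Sum>p\<in>UNIV. scale (str_between (u * inv S \<alpha>) B (\<beta> * S c)) (a * cmp p a1)) = left_term (a, B, c) * a1"
    using sum_cmp[of a1] by (simp add: left_term_def scale_mult_left scale_sum_right[symmetric]
        sum_distrib_left[symmetric])
  finally show ?thesis .
qed

text \<open>Again no rotation is needed: \<open>S(x a)\<close> puts \<open>S(x)\<close> next to \<open>\<alpha>\<close>, which is followed by \<open>y\<close>.\<close>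

lemma right_term_comult_left_homogeneous:
  assumes x: "x \<in> gr r" and y: "y \<in> gr j" and B: "B \<in> endo_gr scaleV grV q" and a: "a \<in> gr p"
  shows "parity_sign (p * (j + k) + q * k) * str_between (u_inv * S \<beta> * S (x * a) * \<alpha>) (\<pi> y \<circ> B) 1 =
    parity_sign ((p + k) * (r + j)) * str_between (u_inv * S \<beta> * S a * (S x * \<alpha> * y)) B 1"
proof -
  define X where "X = str_between (u_inv * S \<beta> * S a * (S x * \<alpha> * y)) B 1"
  have lhs: "str_between (u_inv * S \<beta> * S (x * a) * \<alpha>) (\<pi> y \<circ> B) 1 = parity_sign (r * p) * X"
    by (simp add: X_def str_between_rep_left antipode_mult[OF x a] scale_mult_right scale_mult_left
        str_between_scale_left mult.assoc)
  have "X = 0" if "j + q + p + r \<noteq> 0"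
  proof -
    have "u_inv * S \<beta> * S a * (S x * \<alpha> * y) \<in> gr (0 + 0 + p + (r + 0 + j))"
      by (intro gr_mult antipode_even even_elements x y a)
    then show ?thesis unfolding X_def using that B
      by (auto intro!: str_between_odd gr_one simp: add_ac)
  qed
  then show ?thesis
    unfolding lhs X_def[symmetric]
    by (cases j; cases k; cases q; cases r; cases p) (simp_all add: parity_sign_def)
qed

lemma right_term_comult_left:
  assumes B: "B \<in> endos scaleV"
  shows "(\<Sum>(x, y)\<leftarrow>\<Delta> w. at_product right_term (x, \<pi> y, c1) (a, B, c)) =
    scale (\<epsilon> w) (c1 * right_term (a, B, c))"
proof -
  have Bq: "cmpE q B \<in> endo_gr scaleV grV q" for q using E.comp_works(1)[OF B] .
  define K where "K = (\<lambda>p k q z. scale (str_between (u_inv * S \<beta> * S (cmp p a) * z) (cmpE q B) 1) (cmp k c1 * c))"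
  have K: "K p k q (x + y) = K p k q x + K p k q y" "K p k q (scale l x) = scale l (K p k q x)" for p k q x y l
    by (simp_all add: K_def distrib_left scale_mult_right
        str_between_add_left str_between_scale_left scale_left_distrib)
  have "at_product right_term (x, \<pi> y, c1) (a, B, c) = (\<Sum>p\<in>UNIV. \<Sum>k\<in>UNIV. \<Sum>q\<in>UNIV. \<Sum>r\<in>UNIV. \<Sum>j\<in>UNIV.
      scale (parity_sign ((p + k) * (r + j))) (K p k q (S (cmp r x) * \<alpha> * cmp j y)))" for x y
  proof -
    have split: "str_between (u_inv * S \<beta> * S (x * cmp p a) * \<alpha>) (\<pi> (cmp j y) \<circ> cmpE q B) 1 =
        (\<Sum>r\<in>UNIV. str_between (u_inv * S \<beta> * S (cmp r x * cmp p a) * \<alpha>) (\<pi> (cmp j y) \<circ> cmpE q B) 1)" for p j q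
      by (subst sum_S_mult_cmp(2)[symmetric])
        (simp add: sum_UNIV_bit str_between_add_left distrib_left distrib_right)
    have "at_product right_term (x, \<pi> y, c1) (a, B, c) =
      (\<Sum>j\<in>UNIV. \<Sum>k\<in>UNIV. \<Sum>p\<in>UNIV. \<Sum>q\<in>UNIV. \<Sum>r\<in>UNIV.
        scale (parity_sign (p * (j + k) + q * k) *
          str_between (u_inv * S \<beta> * S (cmp r x * cmp p a) * \<alpha>) (\<pi> (cmp j y) \<circ> cmpE q B) 1) (cmp k c1 * c))"
      by (simp add: at_product_def right_term_def cmpE_rep S_scale scale_mult_right scale_mult_left
          str_between_scale_left split scale_sum_left sum_distrib_left)
    also have "\<dots> = (\<Sum>j\<in>UNIV. \<Sum>k\<in>UNIV. \<Sum>p\<in>UNIV. \<Sum>q\<in>UNIV. \<Sum>r\<in>UNIV.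
      scale (parity_sign ((p + k) * (r + j))) (K p k q (S (cmp r x) * \<alpha> * cmp j y)))"
      by (simp add: right_term_comult_left_homogeneous[OF cmp_in cmp_in Bq cmp_in] K_def)
    also have "\<dots> = (\<Sum>p\<in>UNIV. \<Sum>k\<in>UNIV. \<Sum>q\<in>UNIV. \<Sum>r\<in>UNIV. \<Sum>j\<in>UNIV.
      scale (parity_sign ((p + k) * (r + j))) (K p k q (S (cmp r x) * \<alpha> * cmp j y)))"
      by (simp add: sum_UNIV_bit add_ac)
    finally show ?thesis .
  qed
  then have "(\<Sum>(x, y)\<leftarrow>\<Delta> w. at_product right_term (x, \<pi> y, c1) (a, B, c)) =
      (\<Sum>p\<in>UNIV. \<Sum>k\<in>UNIV. \<Sum>q\<in>UNIV. \<Sum>(x, y)\<leftarrow>\<Delta> w. \<Sum>r\<in>UNIV. \<Sum>j\<in>UNIV.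
      scale (parity_sign ((p + k) * (r + j))) (K p k q (S (cmp r x) * \<alpha> * cmp j y)))"
    by (simp add: case_prod_unfold sum_list_sum_swap)
  also have "\<dots> = scale (\<epsilon> w) (\<Sum>k\<in>UNIV. \<Sum>p\<in>UNIV. \<Sum>q\<in>UNIV. K p k q \<alpha>)"
    by (simp add: antipode_left_twisted[of "K _ _ _", OF K] scale_sum_right)
      (simp add: sum_UNIV_bit add_ac)
  also have "(\<Sum>k\<in>UNIV. \<Sum>p\<in>UNIV. \<Sum>q\<in>UNIV. K p k q \<alpha>) =
      (\<Sum>k\<in>UNIV. scale (\<Sum>p\<in>UNIV. str_between (u_inv * S \<beta> * S (cmp p a) * \<alpha>) B 1) (cmp k c1 * c))"
    by (simp add: K_def scale_sum_left str_between_sum_comp[OF B, symmetric])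
  also have "(\<Sum>p\<in>UNIV. str_between (u_inv * S \<beta> * S (cmp p a) * \<alpha>) B 1) = str_between (u_inv * S \<beta> * S a * \<alpha>) B 1"
    using sum_S_mult_cmp(1)[of 1 a]
    by (simp add: sum_UNIV_bit str_between_add_left[symmetric] distrib_left[symmetric] distrib_right[symmetric])
  also have "(\<Sum>k\<in>UNIV. scale (str_between (u_inv * S \<beta> * S a * \<alpha>) B 1) (cmp k c1 * c)) = c1 * right_term (a, B, c)"
    using sum_cmp[of c1] by (simp add: right_term_def scale_mult_right scale_sum_right[symmetric]
        sum_distrib_right[symmetric])
  finally show ?thesis .
qed

text \<open>
  Rotating \<open>y\<close> to the front and past \<open>u\<^sup>-\<^sup>1\<close> gives \<open>S(S(y)) S(\<beta>) S(x)\<close>, which is \<open>S(x \<beta> S(y))\<close> up to the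
  sign \<open>p q\<close>.
\<close>

lemma right_term_comult_right_homogeneous:
  assumes x: "x \<in> gr p" and y: "y \<in> gr q" and B: "B \<in> endo_gr scaleV grV j" and a: "a \<in> gr r"
  shows "parity_sign (p * (j + k) + q * k) * str_between (u_inv * S \<beta> * S (a * x) * \<alpha>) (B \<circ> \<pi> y) 1 =
    parity_sign ((r + j + k) * (p + q)) * str_between (u_inv * S (x * \<beta> * S y) * S a * \<alpha>) B 1"
proof -
  define X where "X = str_between (y * (u_inv * S \<beta> * S x * S a * \<alpha>)) B 1"
  have B': "B \<in> endos scaleV" using B by (rule endo_gr_endo)
  have "str_between (u_inv * S \<beta> * S (a * x) * \<alpha>) (B \<circ> \<pi> y) 1 =
      parity_sign (r * p) * str_between (u_inv * S \<beta> * S x * S a * \<alpha>) B (1 * y)"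
    by (simp add: str_between_rep_right antipode_mult[OF a x] scale_mult_right scale_mult_left
        str_between_scale_left mult.assoc)
  moreover have "X = parity_sign q * str_between (u_inv * S \<beta> * S x * S a * \<alpha>) B (1 * y)"
    unfolding X_def by (rule str_between_cyclic[OF y B'])
  ultimately have lhs: "str_between (u_inv * S \<beta> * S (a * x) * \<alpha>) (B \<circ> \<pi> y) 1 =
      parity_sign (r * p) * (parity_sign q * X)"
    by (simp add: parity_sign_mult mult.assoc[symmetric])
  have "S (x * \<beta> * S y) = scale (parity_sign (p * q)) (S (S y) * (S \<beta> * S x))"
    using antipode_mult[of "x * \<beta>" p "S y" q] antipode_mult[of x p \<beta> 0] x y
    by (simp add: gr_mult_even beta_even antipode_even)
  then have "u_inv * S (x * \<beta> * S y) * S a * \<alpha> =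
      scale (parity_sign (p * q)) (y * (u_inv * S \<beta> * S x * S a * \<alpha>))"
    by (simp add: scale_mult_right scale_mult_left mult.assoc[symmetric] mult_u_inv)
  then have rhs: "str_between (u_inv * S (x * \<beta> * S y) * S a * \<alpha>) B 1 = parity_sign (p * q) * X"
    by (simp add: X_def str_between_scale_left)
  have "X = 0" if "p + q + j + r \<noteq> 0"
  proof -
    have "y * (u_inv * S \<beta> * S x * S a * \<alpha>) \<in> gr (q + (0 + 0 + p + r + 0))"
      by (intro gr_mult antipode_even even_elements x y a)
    then show ?thesis unfolding X_def using that B
      by (auto intro!: str_between_odd gr_one simp: add_ac)
  qed
  then show ?thesis
    unfolding lhs rhs by (cases j; cases k; cases q; cases r; cases p) (simp_all add: parity_sign_def)
qed

lemma right_term_comult_right: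
  assumes B: "B \<in> endos scaleV"
  shows "(\<Sum>(x, y)\<leftarrow>\<Delta> w. at_product right_term (a, B, c) (x, \<pi> y, c1)) =
    scale (\<epsilon> w) (right_term (a, B, c) * c1)"
proof -
  have Bj: "cmpE j B \<in> endo_gr scaleV grV j" for j using E.comp_works(1)[OF B] .
  define K where "K = (\<lambda>k r j z. scale (str_between (u_inv * S z * S (cmp r a) * \<alpha>) (cmpE j B) 1) (cmp k c * c1))"
  have K: "K k r j (x + y) = K k r j x + K k r j y" "K k r j (scale l x) = scale l (K k r j x)" for k r j x y l
    by (simp_all add: K_def S_add S_scale distrib_left distrib_right scale_mult_right scale_mult_left
        str_between_add_left str_between_scale_left scale_left_distrib)
  have "at_product right_term (a, B, c) (x, \<pi> y, c1) = (\<Sum>k\<in>UNIV. \<Sum>r\<in>UNIV. \<Sum>j\<in>UNIV. \<Sum>p\<in>UNIV. \<Sum>q\<in>UNIV.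
      scale (parity_sign ((r + j + k) * (p + q))) (K k r j (cmp p x * \<beta> * S (cmp q y))))" for x y
  proof -
    have split: "str_between (u_inv * S \<beta> * S (a * cmp p x) * \<alpha>) (cmpE j B \<circ> \<pi> (cmp q y)) 1 =
        (\<Sum>r\<in>UNIV. str_between (u_inv * S \<beta> * S (cmp r a * cmp p x) * \<alpha>) (cmpE j B \<circ> \<pi> (cmp q y)) 1)" for p j q
      by (subst sum_S_mult_cmp(2)[symmetric])
        (simp add: sum_UNIV_bit str_between_add_left distrib_left distrib_right)
    have "at_product right_term (a, B, c) (x, \<pi> y, c1) =
      (\<Sum>j\<in>UNIV. \<Sum>k\<in>UNIV. \<Sum>p\<in>UNIV. \<Sum>q\<in>UNIV. \<Sum>r\<in>UNIV.
        scale (parity_sign (p * (j + k) + q * k) *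
          str_between (u_inv * S \<beta> * S (cmp r a * cmp p x) * \<alpha>) (cmpE j B \<circ> \<pi> (cmp q y)) 1) (cmp k c * c1))"
      by (simp add: at_product_def right_term_def cmpE_rep S_scale scale_mult_right scale_mult_left
          str_between_scale_left split scale_sum_left sum_distrib_left)
    also have "\<dots> = (\<Sum>j\<in>UNIV. \<Sum>k\<in>UNIV. \<Sum>p\<in>UNIV. \<Sum>q\<in>UNIV. \<Sum>r\<in>UNIV.
      scale (parity_sign ((r + j + k) * (p + q))) (K k r j (cmp p x * \<beta> * S (cmp q y))))"
      by (simp add: right_term_comult_right_homogeneous[OF cmp_in cmp_in Bj cmp_in] K_def)
    also have "\<dots> = (\<Sum>k\<in>UNIV. \<Sum>r\<in>UNIV. \<Sum>j\<in>UNIV. \<Sum>p\<in>UNIV. \<Sum>q\<in>UNIV.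
      scale (parity_sign ((r + j + k) * (p + q))) (K k r j (cmp p x * \<beta> * S (cmp q y))))"
      by (simp add: sum_UNIV_bit add_ac)
    finally show ?thesis .
  qed
  then have "(\<Sum>(x, y)\<leftarrow>\<Delta> w. at_product right_term (a, B, c) (x, \<pi> y, c1)) =
      (\<Sum>k\<in>UNIV. \<Sum>r\<in>UNIV. \<Sum>j\<in>UNIV. \<Sum>(x, y)\<leftarrow>\<Delta> w. \<Sum>p\<in>UNIV. \<Sum>q\<in>UNIV.
      scale (parity_sign ((r + j + k) * (p + q))) (K k r j (cmp p x * \<beta> * S (cmp q y))))"
    by (simp add: case_prod_unfold sum_list_sum_swap)
  also have "\<dots> = scale (\<epsilon> w) (\<Sum>k\<in>UNIV. \<Sum>r\<in>UNIV. \<Sum>j\<in>UNIV. K k r j \<beta>)"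
    by (simp add: antipode_right_twisted[of "K _ _ _", OF K] scale_sum_right)
  also have "(\<Sum>k\<in>UNIV. \<Sum>r\<in>UNIV. \<Sum>j\<in>UNIV. K k r j \<beta>) =
      (\<Sum>k\<in>UNIV. scale (\<Sum>r\<in>UNIV. str_between (u_inv * S \<beta> * S (cmp r a) * \<alpha>) B 1) (cmp k c * c1))"
    by (simp add: K_def scale_sum_left str_between_sum_comp[OF B, symmetric])
  also have "(\<Sum>r\<in>UNIV. str_between (u_inv * S \<beta> * S (cmp r a) * \<alpha>) B 1) = str_between (u_inv * S \<beta> * S a * \<alpha>) B 1"
    using sum_S_mult_cmp(1)[of 1 a]
    by (simp add: sum_UNIV_bit str_between_add_left[symmetric] distrib_left[symmetric] distrib_right[symmetric])
  also have "(\<Sum>k\<in>UNIV. scale (str_between (u_inv * S \<beta> * S a * \<alpha>) B 1) (cmp k c * c1)) = right_term (a, B, c) * c1"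
    using sum_cmp[of c] by (simp add: right_term_def scale_mult_left scale_sum_right[symmetric]
        sum_distrib_right[symmetric])
  finally show ?thesis .
qed

section \<open>Centrality of the traced elements\<close>

lemma tensor_eq_endo_sum_list_eq:
  fixes F :: "'a \<times> ('v \<Rightarrow> 'v) \<times> 'a \<Rightarrow> 'a"
  assumes eq: "tensor_eq_endo scale scaleV xs ys"
    and "\<And>a a' B c. B \<in> endos scaleV \<Longrightarrow> F (a + a', B, c) = F (a, B, c) + F (a', B, c)"
    and "\<And>a B B' c. B \<in> endos scaleV \<Longrightarrow> B' \<in> endos scaleV \<Longrightarrow> F (a, B + B', c) = F (a, B, c) + F (a, B', c)"
    and "\<And>a B c c'. B \<in> endos scaleV \<Longrightarrow> F (a, B, c + c') = F (a, B, c) + F (a, B, c')"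
    and "\<And>k a B c. B \<in> endos scaleV \<Longrightarrow> F (scale k a, B, c) = scale k (F (a, B, c))"
    and "\<And>k a B c. B \<in> endos scaleV \<Longrightarrow> F (a, endo_scale scaleV k B, c) = scale k (F (a, B, c))"
    and "\<And>k a B c. B \<in> endos scaleV \<Longrightarrow> F (a, B, scale k c) = scale k (F (a, B, c))"
  shows "(\<Sum>z\<leftarrow>xs. F z) = (\<Sum>z\<leftarrow>ys. F z)"
proof (rule formal_sum_cong_sum_list_eq[OF eq[unfolded tensor_eq_endo_def tensor_eq3_def]])
  have F_0: "F (0, B, c) = 0" if "B \<in> endos scaleV" for B c
    using assms(5)[OF that, of 0 0] by simp
  show "(\<Sum>z\<leftarrow>xs. F z) = (\<Sum>z\<leftarrow>ys. F z)"
    if "trilinear_rel scale (endos scaleV) (endo_scale scaleV) xs ys" for xs ys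
    using that by cases (simp_all add: F_0 assms)
qed

lemma sum_commutes_if_contracts:
  assumes same: "(\<Sum>z\<leftarrow>tensor_mult_endo scale gr scaleV grV D \<theta>. F z) =
      (\<Sum>z\<leftarrow>tensor_mult_endo scale gr scaleV grV \<theta> D. F z)"
    and left: "\<And>t. t \<in> set \<theta> \<Longrightarrow> (\<Sum>d\<leftarrow>D. at_product F d t) = b * F t"
    and right: "\<And>t. t \<in> set \<theta> \<Longrightarrow> (\<Sum>d\<leftarrow>D. at_product F t d) = F t * b"
  shows "(\<Sum>t\<leftarrow>\<theta>. F t) * b = b * (\<Sum>t\<leftarrow>\<theta>. F t)"
proof -
  have "b * (\<Sum>t\<leftarrow>\<theta>. F t) = (\<Sum>t\<leftarrow>\<theta>. \<Sum>d\<leftarrow>D. at_product F d t)"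
    using left by (simp add: sum_list_const_mult[symmetric] cong: map_cong)
  also have "\<dots> = (\<Sum>d\<leftarrow>D. \<Sum>t\<leftarrow>\<theta>. at_product F d t)"
    by (rule sum_list_swap)
  also have "\<dots> = (\<Sum>t\<leftarrow>\<theta>. \<Sum>d\<leftarrow>D. at_product F t d)"
    using same by (simp only: sum_list_tensor_mult_endo)
  also have "\<dots> = (\<Sum>t\<leftarrow>\<theta>. F t) * b"
    using right by (simp add: sum_list_mult_const[symmetric] cong: map_cong)
  finally show ?thesis ..
qed

text \<open>
  Evaluating \<open>left_term\<close> on the two sides of the commutation hypothesis for \<open>b\<close> gives \<open>b C\<close> and
  \<open>C b\<close>: the inner coproduct contracts to a factor \<open>\<epsilon>(w)\<close>, and the counit axiom rebuilds \<open>b\<close> from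
  \<open>\<Sum> \<epsilon>(w) a\<^sub>1\<close>.
\<close>

lemma left_term_central:
  assumes endo: "\<forall>(a, B, c)\<in>set \<theta>. B \<in> endos scaleV"
    and commutes: "\<And>b. let D = [(a1, \<pi> a2, a3). (a1, w) \<leftarrow> \<Delta> b, (a2, a3) \<leftarrow> \<Delta> w] in
        tensor_eq_endo scale scaleV (tensor_mult_endo scale gr scaleV grV D \<theta>)
          (tensor_mult_endo scale gr scaleV grV \<theta> D)"
  shows "central (\<Sum>t\<leftarrow>\<theta>. left_term t)"
  unfolding central_def
proof
  fix b
  let ?C = "\<Sum>t\<leftarrow>\<theta>. left_term t"
  define D where "D = [(a1, \<pi> a2, a3). (a1, w) \<leftarrow> \<Delta> b, (a2, a3) \<leftarrow> \<Delta> w]"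
  have sum_D: "(\<Sum>d\<leftarrow>D. h d) = (\<Sum>(a1, w)\<leftarrow>\<Delta> b. \<Sum>(x, y)\<leftarrow>\<Delta> w. h (a1, \<pi> x, y))" for h :: "_ \<Rightarrow> 'a"
    by (simp add: D_def case_prod_unfold sum_list_concat o_def)
  have left: "(\<Sum>(x, y)\<leftarrow>\<Delta> w. at_product left_term (a1, \<pi> x, y) t) = scale (\<epsilon> w) (a1 * left_term t)"
    and right: "(\<Sum>(x, y)\<leftarrow>\<Delta> w. at_product left_term t (a1, \<pi> x, y)) = scale (\<epsilon> w) (left_term t * a1)"
    if "t \<in> set \<theta>" for t w a1
    using endo that by (cases t; force simp: left_term_comult_left left_term_comult_right)+
  have same: "(\<Sum>z\<leftarrow>tensor_mult_endo scale gr scaleV grV D \<theta>. left_term z) =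
      (\<Sum>z\<leftarrow>tensor_mult_endo scale gr scaleV grV \<theta> D. left_term z)"
    by (rule tensor_eq_endo_sum_list_eq[OF commutes[of b, unfolded Let_def, folded D_def]])
      (simp_all add: left_term_def S_add S_scale distrib_left scale_mult_right str_between_add_mid
        str_between_add_right str_between_scale_mid str_between_scale_right
        scale_left_distrib scale_right_distrib mult.commute)
  show "?C * b = b * ?C"
  proof (rule sum_commutes_if_contracts[OF same])
    fix t assume t: "t \<in> set \<theta>"
    have "(\<Sum>d\<leftarrow>D. at_product left_term d t) = (\<Sum>(a1, w)\<leftarrow>\<Delta> b. scale (\<epsilon> w) a1 * left_term t)"
      by (simp add: sum_D left[OF t] scale_mult_left)
    also have "\<dots> = b * left_term t"
      by (simp add: case_prod_unfold sum_list_mult_const counit_right[unfolded case_prod_unfold])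
    finally show "(\<Sum>d\<leftarrow>D. at_product left_term d t) = b * left_term t" .
    have "(\<Sum>d\<leftarrow>D. at_product left_term t d) = (\<Sum>(a1, w)\<leftarrow>\<Delta> b. left_term t * scale (\<epsilon> w) a1)"
      by (simp add: sum_D right[OF t] scale_mult_right)
    also have "\<dots> = left_term t * b"
      by (simp add: case_prod_unfold sum_list_const_mult counit_right[unfolded case_prod_unfold])
    finally show "(\<Sum>d\<leftarrow>D. at_product left_term t d) = left_term t * b" .
  qed
qed

lemma right_term_central:
  assumes endo: "\<forall>(a, B, c)\<in>set \<theta>. B \<in> endos scaleV"
    and commutes: "\<And>b. let D = [(a1, \<pi> a2, a3). (w, a3) \<leftarrow> \<Delta> b, (a1, a2) \<leftarrow> \<Delta> w] in
        tensor_eq_endo scale scaleV (tensor_mult_endo scale gr scaleV grV \<theta> D)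
          (tensor_mult_endo scale gr scaleV grV D \<theta>)"
  shows "central (\<Sum>t\<leftarrow>\<theta>. right_term t)"
  unfolding central_def
proof
  fix b
  let ?C = "\<Sum>t\<leftarrow>\<theta>. right_term t"
  define D where "D = [(a1, \<pi> a2, a3). (w, a3) \<leftarrow> \<Delta> b, (a1, a2) \<leftarrow> \<Delta> w]"
  have sum_D: "(\<Sum>d\<leftarrow>D. h d) = (\<Sum>(w, c1)\<leftarrow>\<Delta> b. \<Sum>(x, y)\<leftarrow>\<Delta> w. h (x, \<pi> y, c1))" for h :: "_ \<Rightarrow> 'a"
    by (simp add: D_def case_prod_unfold sum_list_concat o_def)
  have left: "(\<Sum>(x, y)\<leftarrow>\<Delta> w. at_product right_term (x, \<pi> y, c1) t) = scale (\<epsilon> w) (c1 * right_term t)"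
    and right: "(\<Sum>(x, y)\<leftarrow>\<Delta> w. at_product right_term t (x, \<pi> y, c1)) = scale (\<epsilon> w) (right_term t * c1)"
    if "t \<in> set \<theta>" for t w c1
    using endo that by (cases t; force simp: right_term_comult_left right_term_comult_right)+
  have "(\<Sum>z\<leftarrow>tensor_mult_endo scale gr scaleV grV \<theta> D. right_term z) =
      (\<Sum>z\<leftarrow>tensor_mult_endo scale gr scaleV grV D \<theta>. right_term z)"
    by (rule tensor_eq_endo_sum_list_eq[OF commutes[of b, unfolded Let_def, folded D_def]])
      (simp_all add: right_term_def S_add S_scale distrib_left distrib_right scale_mult_left
        scale_mult_right str_between_add_left str_between_add_mid
        str_between_scale_left str_between_scale_mid scale_left_distrib scale_right_distrib mult.commute)
  then have same: "(\<Sum>z\<leftarrow>tensor_mult_endo scale gr scaleV grV D \<theta>. right_term z) =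
      (\<Sum>z\<leftarrow>tensor_mult_endo scale gr scaleV grV \<theta> D. right_term z)" ..
  show "?C * b = b * ?C"
  proof (rule sum_commutes_if_contracts[OF same])
    fix t assume t: "t \<in> set \<theta>"
    have "(\<Sum>d\<leftarrow>D. at_product right_term d t) = (\<Sum>(w, c1)\<leftarrow>\<Delta> b. scale (\<epsilon> w) c1 * right_term t)"
      by (simp add: sum_D left[OF t] scale_mult_left)
    also have "\<dots> = b * right_term t"
      by (simp add: case_prod_unfold sum_list_mult_const counit_left[unfolded case_prod_unfold])
    finally show "(\<Sum>d\<leftarrow>D. at_product right_term d t) = b * right_term t" .
    have "(\<Sum>d\<leftarrow>D. at_product right_term t d) = (\<Sum>(w, c1)\<leftarrow>\<Delta> b. right_term t * scale (\<epsilon> w) c1)"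
      by (simp add: sum_D right[OF t] scale_mult_right)
    also have "\<dots> = right_term t * b"
      by (simp add: case_prod_unfold sum_list_const_mult counit_left[unfolded case_prod_unfold])
    finally show "(\<Sum>d\<leftarrow>D. at_product right_term t d) = right_term t * b" .
  qed
qed

end

theorem proposition7:
  fixes scale :: "'k::field \<Rightarrow> 'a::ring_1 \<Rightarrow> 'a" and gr :: "bit \<Rightarrow> 'a set"
    and \<Delta> :: "'a \<Rightarrow> ('a \<times> 'a) list" and \<epsilon> :: "'a \<Rightarrow> 'k"
    and \<Phi> \<Phi>i :: "('a \<times> 'a \<times> 'a) list" and S :: "'a \<Rightarrow> 'a" and \<alpha> \<beta> u u_inv :: 'a
    and scaleV :: "'k \<Rightarrow> 'v::ab_group_add \<Rightarrow> 'v" and grV :: "bit \<Rightarrow> 'v set"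
    and \<pi> :: "'a \<Rightarrow> 'v \<Rightarrow> 'v"
  assumes "quasi_hopf_superalgebra scale gr \<Delta> \<epsilon> \<Phi> \<Phi>i S \<alpha> \<beta>"
    and "u \<in> gr 0" and "u * u_inv = 1" and "u_inv * u = 1"
    and "\<And>a. S (S a) = u * a * u_inv"
    and "graded_module scale gr scaleV grV \<pi>"
    and "finite_dim scaleV"
  shows
    "(\<forall>\<theta> :: ('a \<times> ('v \<Rightarrow> 'v) \<times> 'a) list.
        (\<forall>(a, B, c)\<in>set \<theta>. B \<in> endos scaleV) \<and>
        (\<forall>a. let D = [(a1, \<pi> a2, a3). (a1, w) \<leftarrow> \<Delta> a, (a2, a3) \<leftarrow> \<Delta> w] in
           tensor_eq_endo scale scaleV
             (tensor_mult_endo scale gr scaleV grV D \<theta>)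
             (tensor_mult_endo scale gr scaleV grV \<theta> D)) \<longrightarrow>
        central (\<Sum>(a, B, c)\<leftarrow>\<theta>.
          scale (supertrace scaleV grV (\<pi> u \<circ> \<pi> (inv S \<alpha>) \<circ> B \<circ> \<pi> \<beta> \<circ> \<pi> (S c))) a)) \<and>
     (\<forall>\<theta>' :: ('a \<times> ('v \<Rightarrow> 'v) \<times> 'a) list.
        (\<forall>(a, B, c)\<in>set \<theta>'. B \<in> endos scaleV) \<and>
        (\<forall>a. let D = [(a1, \<pi> a2, a3). (w, a3) \<leftarrow> \<Delta> a, (a1, a2) \<leftarrow> \<Delta> w] in
           tensor_eq_endo scale scaleV
             (tensor_mult_endo scale gr scaleV grV \<theta>' D)
             (tensor_mult_endo scale gr scaleV grV D \<theta>')) \<longrightarrow>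
        central (\<Sum>(a, B, c)\<leftarrow>\<theta>'.
          scale (supertrace scaleV grV (\<pi> u_inv \<circ> \<pi> (S \<beta>) \<circ> \<pi> (S a) \<circ> \<pi> \<alpha> \<circ> B)) c))"
proof -
  interpret M: graded_module scale gr scaleV grV \<pi> by (rule assms(6))
  interpret T: trace_type_module "tensor_eq2 scale" "tensor_eq3 scale UNIV scale" "tensor_eq4 scale"
    "tensor_mult2 scale gr" "tensor_mult3 scale gr (*) gr" "tensor_mult4 scale gr"
    scale gr \<Delta> \<epsilon> \<Phi> \<Phi>i S \<alpha> \<beta> scaleV grV \<pi> u u_inv
    by (intro trace_type_module.intro trace_type_module_axioms.intro finite_dim_graded_module.intro
        finite_dim_graded_module_axioms.intro) (fact assms Pure.reflexive)+
  have left: "(\<Sum>(a, B, c)\<leftarrow>\<theta>.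
      scale (supertrace scaleV grV (\<pi> u \<circ> \<pi> (inv S \<alpha>) \<circ> B \<circ> \<pi> \<beta> \<circ> \<pi> (S c))) a) = (\<Sum>t\<leftarrow>\<theta>. T.left_term t)" for \<theta>
    by (simp add: T.left_term_def M.str_between_def M.rep_mult o_assoc)
  have right: "(\<Sum>(a, B, c)\<leftarrow>\<theta>.
      scale (supertrace scaleV grV (\<pi> u_inv \<circ> \<pi> (S \<beta>) \<circ> \<pi> (S a) \<circ> \<pi> \<alpha> \<circ> B)) c) = (\<Sum>t\<leftarrow>\<theta>. T.right_term t)" for \<theta>
    by (simp add: T.right_term_def M.str_between_def M.rep_mult M.rep_one o_assoc)
  show ?thesis
    unfolding left right using T.left_term_central T.right_term_central by blast
qed

end
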